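(* Let $C$ be a constant such that the number of graphical bipartite degree sequences on $n+n$ vertices is $\Omega(C^n)$. Then for every $\epsilon>0$ there is a polynomial $p$ such that the number of bipartite degree sequences on $n+n$ vertices whose lazy swap Markov chain has relaxation time at most $p(n)$ is $\Omega((C-\epsilon)^n)$.
   Context: A bipartite degree sequence on $n+n$ vertices lists the degrees of the two vertex classes, each of size $n$. It is graphical if a simple bipartite graph realizes it. The lazy swap Markov chain on the realizations does the following at each step: with probability $1/2$ it stays put; otherwise it proposes a swap, replacing edges $ac,bd$ by non-edges $bc,ad$, where $a,b$ are in one class and $c,d$ in the other, and accepts it if the result is a simple realization. The relaxation time is $1/(1-\lambda_2)$, where $\lambda_2$ is the second largest eigenvalue of the transition matrix. Bounded relaxation time of this kind is what the paper calls fast mixing MCMC.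
   Formalization: The claim is stated for 0 < ε ≤ C, so that C−ε is nonnegative; for large ε, such as C = 1 and ε = 101, the literal claim fails because there are at most 16^n graphical sequences. *)

theory Defs
  imports
    "HOL-Probability.Probability"
    "HOL-Library.Landau_Symbols"
    "Jordan_Normal_Form.Char_Poly"
begin

text \<open>A simple bipartite graph on $n+n$ labelled vertices is a set \<open>E \<subseteq> {..<n} \<times> {..<n}\<close>;
  \<open>(u, v) \<in> E\<close> joins vertex \<open>u\<close> of the first class to vertex \<open>v\<close> of the second class.\<close>

type_synonym bigraph = "(nat \<times> nat) set"

text \<open>Degree sequences are listed in non-increasing order within each class. (Counting
  arbitrarily ordered lists instead would make the number of graphical sequences grow faster
  than any exponential.)\<close>

type_synonym bideg_seq = "nat list \<times> nat list"

definition bideg_seqs :: "nat \<Rightarrow> bideg_seq set" where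
  "bideg_seqs n =
     {(d, e). length d = n \<and> length e = n \<and> sorted_wrt (\<ge>) d \<and> sorted_wrt (\<ge>) e}"

definition realizations :: "nat \<Rightarrow> bideg_seq \<Rightarrow> bigraph set" where
  "realizations n s =
     {E. E \<subseteq> {..<n} \<times> {..<n} \<and>
         (\<forall>u<n. card {v. (u, v) \<in> E} = fst s ! u) \<and>
         (\<forall>v<n. card {u. (u, v) \<in> E} = snd s ! v)}"

definition graphical :: "nat \<Rightarrow> bideg_seq \<Rightarrow> bool" where
  "graphical n s \<longleftrightarrow> realizations n s \<noteq> {}"

definition swap_choices :: "nat \<Rightarrow> (nat \<times> nat \<times> nat \<times> nat) set" where
  "swap_choices n = {(a, b, c, d). a < n \<and> b < n \<and> a \<noteq> b \<and> c < n \<and> d < n \<and> c \<noteq> d}"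

definition try_swap :: "nat \<times> nat \<times> nat \<times> nat \<Rightarrow> bigraph \<Rightarrow> bigraph" where
  "try_swap = (\<lambda>(a, b, c, d) G.
     if (a, c) \<in> G \<and> (b, d) \<in> G \<and> (b, c) \<notin> G \<and> (a, d) \<notin> G
     then (G - {(a, c), (b, d)}) \<union> {(b, c), (a, d)} else G)"

text \<open>For \<open>n < 2\<close> there is nothing to choose from, and the chain never moves.\<close>

definition swap_step :: "nat \<Rightarrow> bigraph \<Rightarrow> bigraph pmf" where
  "swap_step n G =
     (if n < 2 then return_pmf G
      else bind_pmf (bernoulli_pmf (1/2)) (\<lambda>stay.
        if stay then return_pmf G
        else map_pmf (\<lambda>q. try_swap q G) (pmf_of_set (swap_choices n))))"

text \<open>The transition matrix, with rows and columns indexed by an arbitrary enumeration of the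
  realizations. Its spectrum does not depend on the enumeration.\<close>

definition transition_matrix :: "nat \<Rightarrow> bideg_seq \<Rightarrow> real mat" where
  "transition_matrix n s =
     (let Gs = (SOME Gs. distinct Gs \<and> set Gs = realizations n s)
      in mat (length Gs) (length Gs) (\<lambda>(i, j). pmf (swap_step n (Gs ! i)) (Gs ! j)))"

text \<open>Real eigenvalues in non-increasing order, repeated according to algebraic multiplicity.
  The transition matrices above are symmetric, so this is their whole spectrum.\<close>

definition eigenvalue_list :: "real mat \<Rightarrow> real list" where
  "eigenvalue_list A = rev (sorted_list_of_multiset (proots (char_poly A)))"

text \<open>The index \<open>1\<close> selects the second largest eigenvalue. The value is extended real so that
  a second eigenvalue \<open>1\<close> gives relaxation time \<open>\<infinity>\<close> rather than \<open>1 / 0 = 0\<close>. If there is a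
  unique realization, there is no second eigenvalue; the chain is stationary
  from the start and its relaxation time is taken to be \<open>1\<close>, the least value possible
  for a lazy chain.\<close>

definition relaxation_time :: "nat \<Rightarrow> bideg_seq \<Rightarrow> ereal" where
  "relaxation_time n s =
     (if card (realizations n s) = 1 then 1
      else 1 / ereal (1 - eigenvalue_list (transition_matrix n s) ! 1))"

definition num_graphical :: "nat \<Rightarrow> nat" where
  "num_graphical n = card {s \<in> bideg_seqs n. graphical n s}"

definition num_fast_mixing :: "real poly \<Rightarrow> nat \<Rightarrow> nat" where
  "num_fast_mixing p n =
     card {s \<in> bideg_seqs n. graphical n s \<and> relaxation_time n s \<le> ereal (poly p (real n))}"

end

theory Submission
  imports Defs "Jordan_Normal_Form.Schur_Decomposition"
begin

text \<open>Two bipartite degree sequences can be composed by joining the left vertices of the first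
  completely to the right vertices of the second. The realizations of the composition are exactly
  the compositions of realizations, and swaps in either factor are swaps of the composition. A
  Poincare inequality for the unnormalized swap chain, in which every swap has rate \<open>1\<close>, therefore
  tensorizes without loss. For a fixed block size \<open>k\<close> all graphical sequences satisfy such an
  inequality with a common constant, because swaps connect the realizations. Composing
  \<open>n div k\<close> blocks of size \<open>k\<close> gives at least \<open>num_graphical k ^ (n div k)\<close> sequences whose
  chains, which pick each swap with probability at least of order \<open>1 / n\<^sup>4\<close>, have relaxation time \<open>O(n\<^sup>4)\<close>. If \<open>k\<close> is
  large, then \<open>num_graphical k\<close> exceeds \<open>(C - \<epsilon>)\<^sup>k\<close>.\<close>

unbundle no vec_syntax

section \<open>Spectral gap from a Poincare inequality\<close>

text \<open>The obstacle is the normalization. The chain proposes one of order n^4 choices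
  uniformly, so composing slows both factors down by rescaling. With rate 1 per choice, the swaps of
  the two factors act on separate coordinates of a product at their original speed, and the constant
  of the Poincare inequality survives any number of compositions. The normalization is paid once, at
  the end. Hence the polynomial has degree 4 for every \<epsilon>, and only its leading coefficient
  depends on \<epsilon>. Connectivity gives each of the finitely many sequences of one block size
  some constant, however bad, and the block size is fixed before n grows. Linear algebra enters
  because the relaxation time is read off the roots of a characteristic polynomial, counted with
  algebraic multiplicity, whereas a Poincare inequality speaks only about vectors of entry sum
  0.\<close>

lemma symmetric_real_char_poly_root_real:
  fixes A :: "real mat"
  assumes A: "A \<in> carrier_mat N N" and sym: "\<And>i j. i < N \<Longrightarrow> j < N \<Longrightarrow> A $$ (i, j) = A $$ (j, i)"
    and root: "poly (char_poly (map_mat of_real A)) z = (0 :: complex)"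
  shows "z \<in> \<real>"
proof -
  let ?A = "map_mat of_real A :: complex mat"
  have cA: "?A \<in> carrier_mat N N" using A by auto
  obtain v where v: "v \<in> carrier_vec N" "v \<noteq> 0\<^sub>v N" "?A *\<^sub>v v = z \<cdot>\<^sub>v v"
    using root eigenvalue_root_char_poly[OF cA] cA unfolding eigenvalue_def eigenvector_def by auto
  have row: "(\<Sum>j<N. of_real (A $$ (i, j)) * v $ j) = z * v $ i" if i: "i < N" for i
  proof -
    have "(?A *\<^sub>v v) $ i = (\<Sum>j<N. of_real (A $$ (i, j)) * v $ j)"
      using i v(1) A by (simp add: scalar_prod_def lessThan_atLeast0)
    then show ?thesis using v i by simp
  qed
  \<comment> \<open>\<open>S\<close> is the Hermitian form of \<open>v\<close>. Evaluated by rows it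
    is \<open>z\<close> times the squared norm \<open>q\<close>; exchanging the two indices shows
    that it equals its own conjugate.\<close>
  define S where "S = (\<Sum>i<N. \<Sum>j<N. of_real (A $$ (i, j)) * v $ j * cnj (v $ i))"
  define q where "q = (\<Sum>i<N. (cmod (v $ i))\<^sup>2)"
  have "S = (\<Sum>i<N. z * v $ i * cnj (v $ i))"
    unfolding S_def by (intro sum.cong refl) (simp add: row flip: sum_distrib_right)
  also have "\<dots> = z * of_real q"
    unfolding q_def of_real_sum sum_distrib_left
    by (intro sum.cong refl) (simp add: complex_norm_square mult.assoc del: of_real_power)
  finally have S: "S = z * of_real q" .
  have "cnj S = (\<Sum>i<N. \<Sum>j<N. of_real (A $$ (i, j)) * cnj (v $ j) * v $ i)"
    unfolding S_def by simp
  also have "\<dots> = (\<Sum>j<N. \<Sum>i<N. of_real (A $$ (i, j)) * cnj (v $ j) * v $ i)"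
    by (rule sum.swap)
  also have "\<dots> = S"
    unfolding S_def by (intro sum.cong refl) (simp add: sym mult_ac)
  finally have "cnj z * of_real q = z * of_real q" using S by simp
  moreover have "q \<noteq> 0"
  proof
    assume "q = 0"
    then have "\<forall>i<N. v $ i = 0"
      unfolding q_def by (subst (asm) sum_nonneg_eq_0_iff) auto
    then have "v = 0\<^sub>v N" using v(1) by auto
    with v(2) show False by simp
  qed
  ultimately show ?thesis by (simp add: Reals_cnj_iff)
qed

text \<open>The polynomial factors over the complex numbers, all its roots are real, and the
  factorization descends because the embedding of real polynomials is injective. So the real roots
  exhaust the degree.\<close>

lemma symmetric_real_char_poly_splits:
  fixes A :: "real mat"
  assumes A: "A \<in> carrier_mat N N" and sym: "\<And>i j. i < N \<Longrightarrow> j < N \<Longrightarrow> A $$ (i, j) = A $$ (j, i)"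
  shows "\<exists>rs. char_poly A = (\<Prod>r\<leftarrow>rs. [:- r, 1:]) \<and> length rs = N"
proof -
  let ?A = "map_mat of_real A :: complex mat"
  have cA: "?A \<in> carrier_mat N N" using A by auto
  obtain as where as: "char_poly ?A = (\<Prod>a\<leftarrow>as. [:- a, 1:])" "length as = N"
    using char_poly_factorized[OF cA] by auto
  have real: "a \<in> \<real>" if "a \<in> set as" for a
  proof (rule symmetric_real_char_poly_root_real[OF A sym])
    show "poly (char_poly ?A) a = 0" using that unfolding as
      by (auto simp: poly_prod_list prod_list_zero_iff image_iff intro!: bexI[of _ a])
  qed
  define rs where "rs = map Re as"
  have as_rs: "as = map of_real rs"
    unfolding rs_def map_map by (rule map_idI[symmetric]) (simp add: real)
  interpret map_poly_inj_idom_hom "of_real :: real \<Rightarrow> complex" ..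
  have "map_poly of_real (char_poly A) = (\<Prod>r\<leftarrow>rs. [:- of_real r, 1:] :: complex poly)"
    using as unfolding of_real_hom.char_poly_hom[OF A, symmetric] as_rs by (simp add: o_def)
  also have "\<dots> = map_poly of_real (\<Prod>r\<leftarrow>rs. [:- r, 1:])"
    by (simp add: hom_prod_list o_def)
  finally have "char_poly A = (\<Prod>r\<leftarrow>rs. [:- r, 1:])" by simp
  then show ?thesis using as(2) rs_def by (intro exI[of _ rs]) simp
qed

lemma mset_eigenvalue_list:
  assumes "char_poly A = (\<Prod>r\<leftarrow>rs. [:- r, 1:])"
  shows "mset (eigenvalue_list A) = mset rs"
proof -
  have "proots (\<Prod>r\<leftarrow>rs. [:- r, 1:]) = mset rs"
    by (induction rs) (simp_all add: proots_mult prod_list_zero_iff image_iff del: mult_pCons_left)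
  then show ?thesis using assms by (simp add: eigenvalue_list_def)
qed

text \<open>The length makes the index \<open>1\<close> meaningful for N \<ge> 2. The factorization
  is the input of the Schur decomposition, which then puts the eigenvalues on the diagonal in the
  order of this list.\<close>

lemma eigenvalue_list_symmetric:
  fixes A :: "real mat"
  assumes A: "A \<in> carrier_mat N N" and sym: "\<And>i j. i < N \<Longrightarrow> j < N \<Longrightarrow> A $$ (i, j) = A $$ (j, i)"
  shows "length (eigenvalue_list A) = N"
    and "char_poly A = (\<Prod>r\<leftarrow>eigenvalue_list A. [:- r, 1:])"
    and "sorted_wrt (\<ge>) (eigenvalue_list A)"
proof -
  obtain rs where rs: "char_poly A = (\<Prod>r\<leftarrow>rs. [:- r, 1:])" "length rs = N"
    using symmetric_real_char_poly_splits[OF A sym] by blast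
  note m = mset_eigenvalue_list[OF rs(1)]
  show "length (eigenvalue_list A) = N" using rs(2) mset_eq_length[OF m] by simp
  have "prod_mset (image_mset (\<lambda>r. [:- r, 1:]) (mset (eigenvalue_list A))) = 
        prod_mset (image_mset (\<lambda>r. [:- r, 1:]) (mset rs))" by (simp only: m)
  then show "char_poly A = (\<Prod>r\<leftarrow>eigenvalue_list A. [:- r, 1:])"
    unfolding rs(1) by (simp add: prod_mset_prod_list flip: mset_map)
  show "sorted_wrt (\<ge>) (eigenvalue_list A)"
    by (simp add: eigenvalue_list_def sorted_wrt_rev)
qed


section \<open>Dirichlet form of a symmetric stochastic matrix and its second eigenvalue\<close>

lemma dirichlet_form_eq:
  fixes a :: "nat \<Rightarrow> nat \<Rightarrow> real"
  assumes sym: "\<And>i j. i < N \<Longrightarrow> j < N \<Longrightarrow> a i j = a j i"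
    and row: "\<And>i. i < N \<Longrightarrow> (\<Sum>j<N. a i j) = 1"
  shows "(\<Sum>i<N. \<Sum>j<N. a i j * (f i - f j)\<^sup>2) =
    2 * (\<Sum>i<N. (f i)\<^sup>2) - 2 * (\<Sum>i<N. f i * (\<Sum>j<N. a i j * f j))"
proof -
  have 1: "(\<Sum>i<N. \<Sum>j<N. a i j * (f i)\<^sup>2) = (\<Sum>i<N. (f i)\<^sup>2)"
    by (intro sum.cong refl) (simp add: row flip: sum_distrib_right)
  have "(\<Sum>i<N. \<Sum>j<N. a i j * (f j)\<^sup>2) = (\<Sum>j<N. \<Sum>i<N. a i j * (f j)\<^sup>2)"
    by (rule sum.swap)
  also have "\<dots> = (\<Sum>i<N. \<Sum>j<N. a i j * (f i)\<^sup>2)"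
    by (intro sum.cong refl) (simp add: sym)
  finally have 2: "(\<Sum>i<N. \<Sum>j<N. a i j * (f j)\<^sup>2) = (\<Sum>i<N. (f i)\<^sup>2)" using 1 by simp
  have "(\<Sum>i<N. \<Sum>j<N. a i j * (f i - f j)\<^sup>2) =
    (\<Sum>i<N. \<Sum>j<N. a i j * (f i)\<^sup>2) + (\<Sum>i<N. \<Sum>j<N. a i j * (f j)\<^sup>2)
      - 2 * (\<Sum>i<N. f i * (\<Sum>j<N. a i j * f j))"
    by (simp add: sum_distrib_left power2_diff algebra_simps sum_subtractf sum.distrib)
  then show ?thesis using 1 2 by simp
qed

lemma sum_pairwise_diff_squares:
  fixes f :: "'a \<Rightarrow> real"
  shows "(\<Sum>i\<in>I. \<Sum>j\<in>I. (f i - f j)\<^sup>2) = 2 * real (card I) * (\<Sum>i\<in>I. (f i)\<^sup>2) - 2 * (\<Sum>i\<in>I. f i)\<^sup>2"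
  by (simp add: power2_diff sum.distrib sum_subtractf sum_distrib_left sum_distrib_right
      power2_eq_square sum_product algebra_simps)

text \<open>For an eigenvector of entry sum 0 and squared norm q, the pair sum is 2 N q and the
  Dirichlet form is 2 (1 - l) q. The inequality with f = v then reads \<gamma> \<le> 1 - l after
  cancelling 2 N q.\<close>

lemma eigenvalue_le_of_poincare:
  fixes A :: "real mat"
  assumes A: "A \<in> carrier_mat N N"
    and sym: "\<And>i j. i < N \<Longrightarrow> j < N \<Longrightarrow> A $$ (i, j) = A $$ (j, i)"
    and row: "\<And>i. i < N \<Longrightarrow> (\<Sum>j<N. A $$ (i, j)) = 1"
    and poincare: "\<And>f. \<gamma> * (\<Sum>i<N. \<Sum>j<N. (f i - f j)\<^sup>2)
      \<le> real N * (\<Sum>i<N. \<Sum>j<N. A $$ (i, j) * (f i - f j)\<^sup>2)"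
    and v: "v \<in> carrier_vec N" "v \<noteq> 0\<^sub>v N" "A *\<^sub>v v = l \<cdot>\<^sub>v v" "(\<Sum>i<N. v $ i) = 0"
  shows "l \<le> 1 - \<gamma>"
proof -
  define q where "q = (\<Sum>i<N. (v $ i)\<^sup>2)"
  have "q \<noteq> 0"
  proof
    assume "q = 0"
    then have "\<forall>i<N. v $ i = 0"
      unfolding q_def by (subst (asm) sum_nonneg_eq_0_iff) auto
    then have "v = 0\<^sub>v N" using v(1) by auto
    with v(2) show False by simp
  qed
  then have q: "q > 0" unfolding q_def by (metis sum_nonneg zero_le_power2 less_eq_real_def)
  have "N \<noteq> 0" using v(1,2) by auto
  have row_v: "(\<Sum>j<N. A $$ (i, j) * v $ j) = l * v $ i" if i: "i < N" for i
  proof -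
    have "(A *\<^sub>v v) $ i = (\<Sum>j<N. A $$ (i, j) * v $ j)"
      using i v(1) A by (simp add: scalar_prod_def lessThan_atLeast0)
    then show ?thesis using v i by simp
  qed
  have "(\<Sum>i<N. v $ i * (\<Sum>j<N. A $$ (i, j) * v $ j)) = (\<Sum>i<N. v $ i * (l * v $ i))"
    by (intro sum.cong refl) (simp only: row_v lessThan_iff)
  then have "(\<Sum>i<N. v $ i * (\<Sum>j<N. A $$ (i, j) * v $ j)) = l * q"
    by (simp only: power2_eq_square q_def sum_distrib_left mult_ac)
  with dirichlet_form_eq[of N "\<lambda>i j. A $$ (i, j)" "\<lambda>i. v $ i", OF sym row]
  have "(\<Sum>i<N. \<Sum>j<N. A $$ (i, j) * (v $ i - v $ j)\<^sup>2) = 2 * q - 2 * (l * q)"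
    unfolding q_def by simp
  moreover have "(\<Sum>i<N. \<Sum>j<N. (v $ i - v $ j)\<^sup>2) = 2 * real N * q"
    by (simp add: sum_pairwise_diff_squares v q_def)
  ultimately have "\<gamma> * (2 * real N * q) \<le> real N * (2 * q - 2 * (l * q))"
    using poincare[of "\<lambda>i. v $ i"] by simp
  then have "2 * real N * q * \<gamma> \<le> 2 * real N * q * (1 - l)" by (simp add: algebra_simps)
  moreover have "2 * real N * q > 0" using q \<open>N \<noteq> 0\<close> by simp
  ultimately have "\<gamma> \<le> 1 - l" by (meson mult_le_cancel_left_pos)
  then show ?thesis by simp
qed

text \<open>The only difficulty is to exclude that \<open>1\<close> is a double root of the characteristic
  polynomial: a Schur decomposition turns a double root into two independent vectors that span
  an invariant plane, and this plane contains a fixed vector with entry sum \<open>0\<close>.\<close>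

lemma second_eigenvalue_le_of_poincare:
  fixes A :: "real mat"
  assumes A: "A \<in> carrier_mat N N" and N: "N \<ge> 2" and \<gamma>: "\<gamma> > 0"
    and sym: "\<And>i j. i < N \<Longrightarrow> j < N \<Longrightarrow> A $$ (i, j) = A $$ (j, i)"
    and row: "\<And>i. i < N \<Longrightarrow> (\<Sum>j<N. A $$ (i, j)) = 1"
    and poincare: "\<And>f. \<gamma> * (\<Sum>i<N. \<Sum>j<N. (f i - f j)\<^sup>2)
      \<le> real N * (\<Sum>i<N. \<Sum>j<N. A $$ (i, j) * (f i - f j)\<^sup>2)"
  shows "eigenvalue_list A ! 1 \<le> 1 - \<gamma>"
proof (rule ccontr)
  assume gap: "\<not> eigenvalue_list A ! 1 \<le> 1 - \<gamma>"
  define es where "es = eigenvalue_list A"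
  note es = eigenvalue_list_symmetric[OF A sym, folded es_def]
  have le: "l \<le> 1 - \<gamma>"
    if "v \<in> carrier_vec N" "v \<noteq> 0\<^sub>v N" "A *\<^sub>v v = l \<cdot>\<^sub>v v" "(\<Sum>i<N. v $ i) = 0" for v l
    by (rule eigenvalue_le_of_poincare[OF A sym row poincare that])
  have es01: "es ! 0 \<ge> es ! 1" using es(1,3) N by (simp add: sorted_wrt_iff_nth_less)
  obtain B P Q where dec: "schur_decomposition A es = (B, P, Q)" by (cases "schur_decomposition A es") auto
  have sw: "similar_mat_wit A B P Q" and ut: "upper_triangular B" and diag: "diag_mat B = es"
    using schur_decomposition[OF A es(2) dec] by auto
  note wit = similar_mat_witD2[OF A sw]
  have B: "B \<in> carrier_mat N N" and P: "P \<in> carrier_mat N N" and Q: "Q \<in> carrier_mat N N"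
    and QP: "Q * P = 1\<^sub>m N" and APBQ: "A = P * B * Q" using wit by auto
  have AP: "A * P = P * B"
    unfolding APBQ using P B Q QP by (simp add: assoc_mult_mat[of _ N N _ N _ N])
  have Bd: "B $$ (i, i) = es ! i" if "i < N" for i
    using diag that B by (auto simp: diag_mat_def)
  have sumA: "(\<Sum>i<N. \<Sum>j<N. A $$ (i, j) * x j) = (\<Sum>j<N. x j)" for x :: "nat \<Rightarrow> real"
  proof -
    have "(\<Sum>i<N. \<Sum>j<N. A $$ (i, j) * x j) = (\<Sum>j<N. \<Sum>i<N. A $$ (i, j) * x j)"
      by (rule sum.swap)
    also have "\<dots> = (\<Sum>j<N. (\<Sum>i<N. A $$ (j, i)) * x j)"
      unfolding sum_distrib_right by (intro sum.cong refl) (simp add: sym)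
    also have "\<dots> = (\<Sum>j<N. x j)" by (intro sum.cong refl) (simp add: row)
    finally show ?thesis .
  qed
  define p0 where "p0 = col P 0"
  define p1 where "p1 = col P 1"
  have p: "p0 \<in> carrier_vec N" "p1 \<in> carrier_vec N" using P by (auto simp: p0_def p1_def)
  have Acol: "A *\<^sub>v col P j = P *\<^sub>v col B j" if "j < N" for j
    using AP P B A that by (metis carrier_matD(2) col_mult2)
  have indep: "x = 0 \<and> y = 0" if "x \<cdot>\<^sub>v p0 + y \<cdot>\<^sub>v p1 = 0\<^sub>v N" for x y
  proof -
    have Qp: "Q *\<^sub>v p0 = unit_vec N 0" "Q *\<^sub>v p1 = unit_vec N 1"
      using N Q P QP by (auto simp: p0_def p1_def simp flip: col_mult2)
    have "Q *\<^sub>v (x \<cdot>\<^sub>v p0 + y \<cdot>\<^sub>v p1) = x \<cdot>\<^sub>v unit_vec N 0 + y \<cdot>\<^sub>v unit_vec N 1"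
      using Q p by (simp add: mult_add_distrib_mat_vec[of _ N N] mult_mat_vec[of _ N N] Qp)
    moreover have "Q *\<^sub>v 0\<^sub>v N = 0\<^sub>v N"
      using Q by (auto simp: scalar_prod_def)
    ultimately have eq: "x \<cdot>\<^sub>v unit_vec N 0 + y \<cdot>\<^sub>v unit_vec N 1 = 0\<^sub>v N"
      unfolding that by simp
    show ?thesis using arg_cong[OF eq, of "\<lambda>v. v $ 0"] arg_cong[OF eq, of "\<lambda>v. v $ 1"] N
      by simp
  qed
  have unit: "P *\<^sub>v unit_vec N j = col P j" if "j < N" for j
    using P that by (intro eq_vecI) (auto simp: scalar_prod_right_unit)
  have col0: "A *\<^sub>v p0 = (es ! 0) \<cdot>\<^sub>v p0"
  proof -
    have c: "col B 0 = (es ! 0) \<cdot>\<^sub>v unit_vec N 0"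
    proof (rule eq_vecI)
      fix i assume "i < dim_vec ((es ! 0) \<cdot>\<^sub>v unit_vec N 0)"
      then show "col B 0 $ i = ((es ! 0) \<cdot>\<^sub>v unit_vec N 0) $ i"
        using B Bd[of 0] upper_triangularD[OF ut, of 0 i] N by (cases "i = 0") auto
    qed (use B in simp)
    show ?thesis using Acol[of 0] N P unit[of 0] unfolding c p0_def
      by (simp add: mult_mat_vec[of _ N N])
  qed
  define b where "b = B $$ (0, 1)"
  have col1: "A *\<^sub>v p1 = b \<cdot>\<^sub>v p0 + (es ! 1) \<cdot>\<^sub>v p1"
  proof -
    have c: "col B 1 = b \<cdot>\<^sub>v unit_vec N 0 + (es ! 1) \<cdot>\<^sub>v unit_vec N 1"
    proof (rule eq_vecI)
      fix i assume "i < dim_vec (b \<cdot>\<^sub>v unit_vec N 0 + (es ! 1) \<cdot>\<^sub>v unit_vec N 1)"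
      then show "col B 1 $ i = (b \<cdot>\<^sub>v unit_vec N 0 + (es ! 1) \<cdot>\<^sub>v unit_vec N 1) $ i"
        using B Bd[of 1] upper_triangularD[OF ut, of 1 i] N
        by (cases "i = 0"; cases "i = 1") (auto simp: b_def)
    qed (use B in simp)
    show ?thesis using Acol[of 1] N P unit[of 0] unit[of 1] unfolding c p0_def p1_def
      by (simp add: mult_mat_vec[of _ N N] mult_add_distrib_mat_vec[of _ N N])
  qed
  define S where "S = (\<lambda>v :: real vec. \<Sum>i<N. v $ i)"
  have SA: "S (A *\<^sub>v v) = S v" if "v \<in> carrier_vec N" for v
  proof -
    have "S (A *\<^sub>v v) = (\<Sum>i<N. \<Sum>j<N. A $$ (i, j) * v $ j)"
      unfolding S_def using A that
      by (intro sum.cong refl) (simp add: scalar_prod_def lessThan_atLeast0)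
    then show ?thesis using sumA[of "\<lambda>j. v $ j"] by (simp add: S_def)
  qed
  have S_add: "S (v + w) = S v + S w" if "v \<in> carrier_vec N" "w \<in> carrier_vec N" for v w
    using that by (simp add: S_def sum.distrib)
  have S_smult: "S (c \<cdot>\<^sub>v v) = c * S v" if "v \<in> carrier_vec N" for v c
    using that by (simp add: S_def sum_distrib_left)
  \<comment> \<open>An eigenvalue above 1 - \<gamma> admits no eigenvector of entry sum 0. By
    symmetry the columns of \<open>A\<close> also sum to 1, so \<open>A\<close> preserves entry
    sums, and l * S v = S v forces l = 1.\<close>
  have one: "l = 1 \<and> S v \<noteq> 0"
    if "v \<in> carrier_vec N" "v \<noteq> 0\<^sub>v N" "A *\<^sub>v v = l \<cdot>\<^sub>v v" "l > 1 - \<gamma>" for l v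
  proof -
    have "S v \<noteq> 0" using le[OF that(1-3)] that(4) by (auto simp: S_def)
    moreover have "l * S v = S v" using SA[OF that(1)] S_smult[OF that(1)] that(3) by simp
    ultimately show ?thesis by simp
  qed
  have p0nz: "p0 \<noteq> 0\<^sub>v N"
  proof
    assume "p0 = 0\<^sub>v N"
    then have "1 \<cdot>\<^sub>v p0 + 0 \<cdot>\<^sub>v p1 = 0\<^sub>v N" using p by auto
    then show False using indep by fastforce
  qed
  have e0: "es ! 0 = 1" and Sp0: "S p0 \<noteq> 0"
    using one[OF p(1) p0nz col0] gap es01 by (auto simp: es_def)
  have e1: "es ! 1 = 1"
  proof -
    have "es ! 1 \<in> set es" using es(1) N by simp
    then have "poly (\<Prod>r\<leftarrow>es. [:- r, 1:]) (es ! 1) = 0"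
      by (force simp: poly_prod_list prod_list_zero_iff image_iff)
    then have "poly (char_poly A) (es ! 1) = 0" using es(2) by metis
    then obtain v where "v \<in> carrier_vec N" "v \<noteq> 0\<^sub>v N" "A *\<^sub>v v = (es ! 1) \<cdot>\<^sub>v v"
      using eigenvalue_root_char_poly[OF A] A unfolding eigenvalue_def eigenvector_def by auto
    then show ?thesis using one gap by (auto simp: es_def)
  qed
  \<comment> \<open>Taking entry sums in A p1 = b p0 + p1 kills the off-diagonal entry
    \<open>b\<close>, so that \<open>p1\<close> is fixed by \<open>A\<close> just like
    \<open>p0\<close>.\<close>
  have "b * S p0 + S p1 = S p1"
    using SA[OF p(2)] unfolding col1 e1 using p by (simp add: S_add S_smult)
  then have b: "b = 0" using Sp0 by simp
  have Ap: "A *\<^sub>v p0 = p0" "A *\<^sub>v p1 = p1"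
  proof -
    have "1 \<cdot>\<^sub>v p0 = p0" "0 \<cdot>\<^sub>v p0 + 1 \<cdot>\<^sub>v p1 = p1" using p by auto
    then show "A *\<^sub>v p0 = p0" "A *\<^sub>v p1 = p1"
      using col0 col1 unfolding e0 e1 b by simp_all
  qed
  define w where "w = S p1 \<cdot>\<^sub>v p0 + (- S p0) \<cdot>\<^sub>v p1"
  have w: "w \<in> carrier_vec N" "w \<noteq> 0\<^sub>v N"
    using p indep[of "S p1" "- S p0"] Sp0 by (auto simp: w_def)
  have Aw: "A *\<^sub>v w = 1 \<cdot>\<^sub>v w"
    unfolding w_def using A p by (simp add: mult_add_distrib_mat_vec[of _ N N] mult_mat_vec[of _ N N] Ap)
  have "S w \<noteq> 0" using one[OF w Aw] \<gamma> by simp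
  moreover have "S w = 0" unfolding w_def using p by (simp add: S_add S_smult)
  ultimately show False by simp
qed

section \<open>Connectivity under swaps\<close>

text \<open>No bound on the vertices appears, so the relation is unaffected when a vertex is removed
  or added back. The four membership conditions already imply a \<noteq> b and c \<noteq> d.\<close>

definition swap_adj :: "bigraph \<Rightarrow> bigraph \<Rightarrow> bool" where
  "swap_adj X Y \<longleftrightarrow> (\<exists>a b c d. (a, c) \<in> X \<and> (b, d) \<in> X \<and> (b, c) \<notin> X \<and> (a, d) \<notin> X \<and>
     Y = (X - {(a, c), (b, d)}) \<union> {(b, c), (a, d)})"

definition same_degrees :: "bigraph \<Rightarrow> bigraph \<Rightarrow> bool" where
  "same_degrees X Y \<longleftrightarrow> (\<forall>u. card (X `` {u}) = card (Y `` {u})) \<and> (\<forall>v. card (X\<inverse> `` {v}) = card (Y\<inverse> `` {v}))"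

lemma same_degrees_sym: "same_degrees X Y \<Longrightarrow> same_degrees Y X"
  by (simp add: same_degrees_def)

lemma same_degrees_trans: "same_degrees X Y \<Longrightarrow> same_degrees Y Z \<Longrightarrow> same_degrees X Z"
  by (simp add: same_degrees_def)

lemma swap_adj_sym: "swap_adj X Y \<Longrightarrow> swap_adj Y X"
proof -
  assume "swap_adj X Y"
  then obtain a b c d where *: "(a, c) \<in> X" "(b, d) \<in> X" "(b, c) \<notin> X" "(a, d) \<notin> X"
    "Y = (X - {(a, c), (b, d)}) \<union> {(b, c), (a, d)}" unfolding swap_adj_def by blast
  then have "a \<noteq> b" "c \<noteq> d" by auto
  with * have "(b, c) \<in> Y \<and> (a, d) \<in> Y \<and> (a, c) \<notin> Y \<and> (b, d) \<notin> Y \<and>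
      X = (Y - {(b, c), (a, d)}) \<union> {(a, c), (b, d)}" by auto
  then show "swap_adj Y X" unfolding swap_adj_def by blast
qed

lemma card_exchange: "finite S \<Longrightarrow> x \<in> S \<Longrightarrow> y \<notin> S \<Longrightarrow> card (insert y (S - {x})) = card S"
  by (metis card.insert_remove card_insert_if card_Suc_Diff1 Diff_iff finite_Diff)

lemma swap_adj_same_degrees:
  assumes "swap_adj X Y" "finite X"
  shows "same_degrees X Y"
proof -
  obtain a b c d where *: "(a, c) \<in> X" "(b, d) \<in> X" "(b, c) \<notin> X" "(a, d) \<notin> X"
    and Y: "Y = (X - {(a, c), (b, d)}) \<union> {(b, c), (a, d)}" using assms unfolding swap_adj_def by blast
  from * have ne: "a \<noteq> b" "c \<noteq> d" by auto
  have fin: "finite (X `` {u})" "finite (X\<inverse> `` {v})" for u v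
    using assms(2) by (auto intro: finite_Image)
  have row: "Y `` {u} = (if u = a then insert d (X `` {a} - {c})
      else if u = b then insert c (X `` {b} - {d}) else X `` {u})" for u
    using ne unfolding Y by auto
  have col: "Y\<inverse> `` {v} = (if v = c then insert b (X\<inverse> `` {c} - {a})
      else if v = d then insert a (X\<inverse> `` {d} - {b}) else X\<inverse> `` {v})" for v
    using ne unfolding Y by auto
  have "card (insert d (X `` {a} - {c})) = card (X `` {a})" "card (insert c (X `` {b} - {d})) = card (X `` {b})"
    "card (insert b (X\<inverse> `` {c} - {a})) = card (X\<inverse> `` {c})" "card (insert a (X\<inverse> `` {d} - {b})) = card (X\<inverse> `` {d})"
    by (rule card_exchange; use * fin in simp)+
  then show ?thesis unfolding same_degrees_def row col by (simp only: split: if_split) simp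
qed

lemma swap_adj_subset: "swap_adj X Y \<Longrightarrow> X \<subseteq> A \<times> V \<Longrightarrow> Y \<subseteq> A \<times> V"
  unfolding swap_adj_def by (elim exE conjE) auto

lemma swap_adj_add_row:
  assumes "swap_adj X Y" "X \<subseteq> A \<times> V" "u \<notin> A"
  shows "swap_adj (X \<union> {u} \<times> N) (Y \<union> {u} \<times> N)"
proof -
  obtain a b c d where *: "(a, c) \<in> X" "(b, d) \<in> X" "(b, c) \<notin> X" "(a, d) \<notin> X"
    and Y: "Y = (X - {(a, c), (b, d)}) \<union> {(b, c), (a, d)}" using assms unfolding swap_adj_def by blast
  have "a \<noteq> u" "b \<noteq> u" using * assms by auto
  then have "(a, c) \<in> X \<union> {u} \<times> N \<and> (b, d) \<in> X \<union> {u} \<times> N \<and> (b, c) \<notin> X \<union> {u} \<times> N \<and>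
      (a, d) \<notin> X \<union> {u} \<times> N \<and>
      Y \<union> {u} \<times> N = (X \<union> {u} \<times> N - {(a, c), (b, d)}) \<union> {(b, c), (a, d)}"
    unfolding Y using * by auto
  then show ?thesis unfolding swap_adj_def by blast
qed

lemma swap_adj_rtranclp_add_row:
  assumes "swap_adj\<^sup>*\<^sup>* X Y" "X \<subseteq> A \<times> V" "u \<notin> A"
  shows "Y \<subseteq> A \<times> V \<and> swap_adj\<^sup>*\<^sup>* (X \<union> {u} \<times> N) (Y \<union> {u} \<times> N)"
  using assms(1)
proof (induction rule: rtranclp_induct)
  case base
  then show ?case using assms by simp
next
  case (step Y Z)
  then show ?case
    using swap_adj_add_row[OF step(2) _ assms(3)] swap_adj_subset[OF step(2)]
    by (meson rtranclp.rtrancl_into_rtrancl)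
qed

text \<open>The column of \<open>w\<close> is no smaller than that of \<open>v\<close> and misses
  \<open>u\<close>, which the column of \<open>v\<close> contains. Some u' therefore lies in the
  column of \<open>w\<close> only, and it trades \<open>v\<close> for \<open>w\<close> with
  \<open>u\<close>.\<close>

lemma swap_into_larger_column:
  assumes X: "finite X" and v: "(u, v) \<in> X" and w: "(u, w) \<notin> X"
    and le: "card (X\<inverse> `` {v}) \<le> card (X\<inverse> `` {w})"
  shows "\<exists>X'. swap_adj X X' \<and> X' `` {u} = insert w (X `` {u} - {v})"
proof -
  have fin: "finite (X\<inverse> `` {v})" using X by (auto intro: finite_Image)
  have "\<not> X\<inverse> `` {w} \<subset> X\<inverse> `` {v}" using psubset_card_mono[OF fin, of "X\<inverse> `` {w}"] le by auto
  then obtain u' where u': "(u', w) \<in> X" "(u', v) \<notin> X" using v w by auto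
  define X' where "X' = (X - {(u, v), (u', w)}) \<union> {(u', v), (u, w)}"
  have "swap_adj X X'" unfolding swap_adj_def X'_def using u' v w by blast
  moreover have "X' `` {u} = insert w (X `` {u} - {v})"
    unfolding X'_def using u' v w by auto
  ultimately show ?thesis by blast
qed

text \<open>Remove a left vertex \<open>u\<close> once its neighbourhoods in both graphs agree. If they differ in
  \<open>v\<close> and \<open>w\<close>, the right vertex of larger degree can be swapped into the neighbourhood of \<open>u\<close>
  in whichever graph misses it.\<close>

lemma swap_connected:
  assumes "finite A" "finite V" "X \<subseteq> A \<times> V" "Y \<subseteq> A \<times> V" "same_degrees X Y"
  shows "swap_adj\<^sup>*\<^sup>* X Y"
  using assms(1,3-)
proof (induction A arbitrary: X Y rule: finite_induct)
  case empty
  then show ?case by simp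
next
  case (insert u A)
  let ?A = "insert u A"
  have fin: "finite X" if "X \<subseteq> ?A \<times> V" for X
    using that insert(1) assms(2) by (meson finite_SigmaI finite_insert finite_subset)
  show ?case using insert.prems
  \<comment> \<open>This inner induction counts the neighbours of \<open>u\<close> in
    \<open>X\<close> that are missing in \<open>Y\<close>. A swap lowers the count by one whether it
    is made in \<open>X\<close> or in \<open>Y\<close>; in the latter case it is appended to the
    path in reverse.\<close>
  proof (induction "card (X `` {u} - Y `` {u})" arbitrary: X Y)
    case 0
    note fX = fin[OF 0(2)] and fY = fin[OF 0(3)]
    have finr: "finite (X `` {u})" "finite (Y `` {u})"
      using fX fY by (auto intro: finite_Image)
    have "X `` {u} \<subseteq> Y `` {u}" using 0(1) finr by auto
    moreover have "card (X `` {u}) = card (Y `` {u})" using 0(4) by (simp add: same_degrees_def)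
    ultimately have eq: "X `` {u} = Y `` {u}" using finr by (simp add: card_subset_eq)
    define X' where "X' = X - {u} \<times> UNIV"
    define Y' where "Y' = Y - {u} \<times> UNIV"
    have XY: "X = X' \<union> {u} \<times> (X `` {u})" "Y = Y' \<union> {u} \<times> (X `` {u})"
      unfolding X'_def Y'_def using eq by auto
    have sub: "X' \<subseteq> A \<times> V" "Y' \<subseteq> A \<times> V" using 0(2,3) by (auto simp: X'_def Y'_def)
    have "same_degrees X' Y'"
      unfolding same_degrees_def
    proof (intro conjI allI)
      fix w
      have "X' `` {w} = (if w = u then {} else X `` {w})" "Y' `` {w} = (if w = u then {} else Y `` {w})"
        by (auto simp: X'_def Y'_def)
      then show "card (X' `` {w}) = card (Y' `` {w})" using 0(4) by (simp add: same_degrees_def)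
    next
      fix w
      have "X'\<inverse> `` {w} = X\<inverse> `` {w} - {u}" "Y'\<inverse> `` {w} = Y\<inverse> `` {w} - {u}"
        by (auto simp: X'_def Y'_def)
      moreover have "u \<in> X\<inverse> `` {w} \<longleftrightarrow> u \<in> Y\<inverse> `` {w}" using eq by auto
      ultimately show "card (X'\<inverse> `` {w}) = card (Y'\<inverse> `` {w})"
        using 0(4) by (simp add: same_degrees_def card_Diff_singleton_if)
    qed
    from swap_adj_rtranclp_add_row[OF insert.IH[OF sub this] sub(1) insert.hyps(2), of "X `` {u}"]
    show ?case unfolding XY[symmetric] by blast
  next
    case (Suc n)
    note fX = fin[OF Suc(3)] and fY = fin[OF Suc(4)]
    have finr: "finite (X `` {u})" "finite (Y `` {u})"
      using fX fY by (auto intro: finite_Image)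
    have card_eq: "card (X `` {u}) = card (Y `` {u})" using Suc(5) by (simp add: same_degrees_def)
    obtain v where v: "(u, v) \<in> X" "(u, v) \<notin> Y" using Suc(2)
      by (metis Diff_iff Image_singleton_iff card.empty equals0I nat.distinct(1))
    have "\<not> Y `` {u} \<subseteq> X `` {u}"
      using card_subset_eq[OF finr(1), of "Y `` {u}"] card_eq v by auto
    then obtain w where w: "(u, w) \<in> Y" "(u, w) \<notin> X" by auto
    have n: "n = card (X `` {u} - Y `` {u} - {v})" using Suc(2) v finr by simp
    show ?case
    proof (cases "card (X\<inverse> `` {v}) \<le> card (X\<inverse> `` {w})")
      case True
      from swap_into_larger_column[OF fX v(1) w(2) True]
      obtain X' where X': "swap_adj X X'" "X' `` {u} = insert w (X `` {u} - {v})" by blast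
      have "swap_adj\<^sup>*\<^sup>* X' Y"
      proof (rule Suc(1))
        have "X' `` {u} - Y `` {u} = X `` {u} - Y `` {u} - {v}" using X'(2) w by auto
        then show "n = card (X' `` {u} - Y `` {u})" using n by simp
        show "X' \<subseteq> ?A \<times> V" using swap_adj_subset[OF X'(1) Suc(3)] .
        show "same_degrees X' Y"
          using swap_adj_same_degrees[OF X'(1) fX] Suc(5) same_degrees_sym same_degrees_trans by blast
      qed (fact Suc(4))
      then show ?thesis using X'(1) by (rule converse_rtranclp_into_rtranclp[rotated])
    next
      case False
      then have "card (Y\<inverse> `` {w}) \<le> card (Y\<inverse> `` {v})"
        using Suc(5) by (simp add: same_degrees_def)
      from swap_into_larger_column[OF fY w(1) v(2) this]
      obtain Y' where Y': "swap_adj Y Y'" "Y' `` {u} = insert v (Y `` {u} - {w})" by blast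
      have "swap_adj\<^sup>*\<^sup>* X Y'"
      proof (rule Suc(1))
        have "X `` {u} - Y' `` {u} = X `` {u} - Y `` {u} - {v}" using Y'(2) w by auto
        then show "n = card (X `` {u} - Y' `` {u})" using n by simp
        show "Y' \<subseteq> ?A \<times> V" using swap_adj_subset[OF Y'(1) Suc(4)] .
        show "same_degrees X Y'"
          using swap_adj_same_degrees[OF Y'(1) fY] Suc(5) same_degrees_trans by blast
      qed (fact Suc(3))
      then show ?thesis using swap_adj_sym[OF Y'(1)] by (rule rtranclp.rtrancl_into_rtrancl)
    qed
  qed
qed

section \<open>Swap choices acting on the realizations of a degree sequence\<close>

lemma finite_swap_choices [simp]: "finite (swap_choices n)"
  by (rule finite_subset[of _ "{..<n} \<times> {..<n} \<times> {..<n} \<times> {..<n}"]) (auto simp: swap_choices_def)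

lemma realizations_iff:
  "E \<in> realizations n s \<longleftrightarrow> E \<subseteq> {..<n} \<times> {..<n} \<and>
     (\<forall>u<n. card (E `` {u}) = fst s ! u) \<and> (\<forall>v<n. card (E\<inverse> `` {v}) = snd s ! v)"
  unfolding realizations_def by (simp add: Image_singleton)

lemma finite_realizations [simp]: "finite (realizations n s)"
  by (rule finite_subset[of _ "Pow ({..<n} \<times> {..<n})"]) (auto simp: realizations_def)

lemma realizations_same_degrees:
  assumes "X \<in> realizations n s" "Y \<subseteq> {..<n} \<times> {..<n}"
  shows "Y \<in> realizations n s \<longleftrightarrow> same_degrees X Y"
proof -
  have row: "E `` {u} = {}" if "E \<subseteq> {..<n} \<times> {..<n}" "\<not> u < n" for E :: bigraph and u using that by auto
  have col: "E\<inverse> `` {u} = {}" if "E \<subseteq> {..<n} \<times> {..<n}" "\<not> u < n" for E :: bigraph and u using that by auto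
  show ?thesis
    using assms row[of X] row[of Y] col[of X] col[of Y] unfolding realizations_iff same_degrees_def
    by (metis (no_types, lifting))
qed

lemma try_swap_cases: "try_swap q G = G \<or> swap_adj G (try_swap q G)"
proof (cases q)
  case (fields a b c d)
  then show ?thesis unfolding try_swap_def swap_adj_def by auto
qed

lemma try_swap_realizations:
  assumes "G \<in> realizations n s"
  shows "try_swap q G \<in> realizations n s"
  using try_swap_cases[of q G]
proof
  assume adj: "swap_adj G (try_swap q G)"
  have sub: "G \<subseteq> {..<n} \<times> {..<n}" using assms by (simp add: realizations_iff)
  then have "finite G" by (meson finite_SigmaI finite_lessThan finite_subset)
  then show ?thesis
    using realizations_same_degrees[OF assms swap_adj_subset[OF adj sub]] swap_adj_same_degrees[OF adj]
    by simp
qed (use assms in simp)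

lemma swap_adj_try_swap:
  assumes "swap_adj G H" "G \<subseteq> {..<n} \<times> {..<n}"
  shows "\<exists>q\<in>swap_choices n. H = try_swap q G"
proof -
  obtain a b c d where *: "(a, c) \<in> G" "(b, d) \<in> G" "(b, c) \<notin> G" "(a, d) \<notin> G"
    "H = (G - {(a, c), (b, d)}) \<union> {(b, c), (a, d)}" using assms unfolding swap_adj_def by blast
  then have "(a, b, c, d) \<in> swap_choices n" using assms(2) by (auto simp: swap_choices_def)
  moreover have "H = try_swap (a, b, c, d) G" using * by (simp add: try_swap_def)
  ultimately show ?thesis by blast
qed

lemma realizations_connected:
  assumes "X \<in> realizations n s" "Y \<in> realizations n s"
  shows "swap_adj\<^sup>*\<^sup>* X Y"
  using assms realizations_same_degrees[OF assms(1), of Y]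
  by (intro swap_connected[of "{..<n}" "{..<n}"]) (auto simp: realizations_iff)

section \<open>Poincare inequality of the unnormalized swap chain\<close>

definition dirichlet :: "nat \<Rightarrow> bideg_seq \<Rightarrow> (bigraph \<Rightarrow> real) \<Rightarrow> real" where
  "dirichlet n s f = (\<Sum>G\<in>realizations n s. \<Sum>q\<in>swap_choices n. (f (try_swap q G) - f G)\<^sup>2)"

text \<open>The pair sum is twice the squared number of realizations times the variance under the
  uniform distribution. The factor \<open>card\<close> on the right makes \<open>K\<close> a bound
  on the inverse spectral gap of the continuous-time chain in which every choice has rate 1,
  whatever the number of realizations.\<close>

definition poincare :: "real \<Rightarrow> nat \<Rightarrow> bideg_seq \<Rightarrow> bool" where
  "poincare K n s \<longleftrightarrow> (\<forall>f. (\<Sum>G\<in>realizations n s. \<Sum>H\<in>realizations n s. (f G - f H)\<^sup>2)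
     \<le> K * real (card (realizations n s)) * dirichlet n s f)"

lemma dirichlet_nonneg: "dirichlet n s f \<ge> 0"
  unfolding dirichlet_def by (intro sum_nonneg) simp

lemma poincare_mono: "poincare K n s \<Longrightarrow> K \<le> L \<Longrightarrow> poincare L n s"
  unfolding poincare_def
  by (meson dirichlet_nonneg mult_right_mono of_nat_0_le_iff order_trans)

lemma diff_square_le_dirichlet:
  assumes "G \<in> realizations n s" "H \<in> realizations n s"
  shows "\<exists>c\<ge>0. \<forall>f. (f G - f H)\<^sup>2 \<le> c * dirichlet n s f"
proof -
  have "H \<in> realizations n s \<and> (\<exists>c\<ge>0. \<forall>f. (f G - f H)\<^sup>2 \<le> c * dirichlet n s f)"
    using realizations_connected[OF assms]
  proof (induction rule: rtranclp_induct)
    case base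
    then show ?case using assms by (auto intro!: exI[of _ 0])
  next
    case (step H J)
    then obtain c where H: "H \<in> realizations n s" and c: "c \<ge> 0"
      "\<And>f. (f G - f H)\<^sup>2 \<le> c * dirichlet n s f" by blast
    obtain q where q: "q \<in> swap_choices n" "J = try_swap q H"
      using swap_adj_try_swap[OF step(2), of n] H unfolding realizations_iff by blast
    have J: "J \<in> realizations n s" using q(2) try_swap_realizations[OF H] by simp
    \<comment> \<open>One more swap costs at most one term of the Dirichlet sum, and (x + y)^2 \<le>
      2 x^2 + 2 y^2 turns the constant \<open>c\<close> into 2 c + 2. The growth along the path is
      harmless because only existence is claimed.\<close>
    have "(f G - f J)\<^sup>2 \<le> (2 * c + 2) * dirichlet n s f" for f :: "bigraph \<Rightarrow> real"
    proof -
      have "(f J - f H)\<^sup>2 \<le> (\<Sum>q\<in>swap_choices n. (f (try_swap q H) - f H)\<^sup>2)"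
        unfolding q(2) by (rule member_le_sum) (use q in auto)
      also have "\<dots> \<le> dirichlet n s f"
        unfolding dirichlet_def
        by (rule member_le_sum[of H _ "\<lambda>H. \<Sum>q\<in>swap_choices n. (f (try_swap q H) - f H)\<^sup>2"])
          (use H in \<open>auto intro: sum_nonneg\<close>)
      finally have 1: "(f J - f H)\<^sup>2 \<le> dirichlet n s f" .
      have "0 \<le> ((f G - f H) + (f J - f H))\<^sup>2" by simp
      then have "(f G - f J)\<^sup>2 \<le> 2 * (f G - f H)\<^sup>2 + 2 * (f J - f H)\<^sup>2"
        by (simp add: power2_eq_square algebra_simps)
      with 1 c(2)[of f] show ?thesis by (simp add: algebra_simps)
    qed
    then show ?case using J c(1) by (intro conjI exI[of _ "2 * c + 2"]) auto
  qed
  then show ?thesis by blast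
qed

text \<open>Adding up the constants of all pairs of realizations gives a crude \<open>K\<close>,
  which suffices since it is applied at one fixed block size.\<close>

lemma poincare_exists: "\<exists>K. poincare K n s"
proof -
  let ?R = "realizations n s"
  obtain c where c: "\<And>G H. G \<in> ?R \<Longrightarrow> H \<in> ?R \<Longrightarrow> c G H \<ge> 0 \<and> (\<forall>f. (f G - f H)\<^sup>2 \<le> c G H * dirichlet n s f)"
    using diff_square_le_dirichlet[of _ n s] by metis
  define K where "K = (\<Sum>G\<in>?R. \<Sum>H\<in>?R. c G H)"
  have K: "K \<ge> 0" unfolding K_def using c by (intro sum_nonneg) auto
  have "(\<Sum>G\<in>?R. \<Sum>H\<in>?R. (f G - f H)\<^sup>2) \<le> K * real (card ?R) * dirichlet n s f" for f
  proof (cases "?R = {}")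
    case False
    then have card: "real (card ?R) \<ge> 1" by (simp add: Suc_le_eq card_gt_0_iff)
    have "(\<Sum>G\<in>?R. \<Sum>H\<in>?R. (f G - f H)\<^sup>2) \<le> (\<Sum>G\<in>?R. \<Sum>H\<in>?R. c G H * dirichlet n s f)"
      using c by (intro sum_mono) auto
    also have "\<dots> = K * dirichlet n s f" by (simp add: K_def sum_distrib_right)
    also have "\<dots> \<le> K * real (card ?R) * dirichlet n s f"
      using K card dirichlet_nonneg[of n s f] by (intro mult_right_mono) (auto simp: mult_le_cancel_left1)
    finally show ?thesis .
  qed simp
  then show ?thesis unfolding poincare_def by blast
qed

section \<open>Composition of degree sequences\<close>

text \<open>The composition joins every left vertex of the first graph to every right vertex of the
  second. The right vertices of the second graph come first, which keeps both degree lists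
  sorted.\<close>

definition compose_bigraph :: "nat \<Rightarrow> nat \<Rightarrow> bigraph \<Rightarrow> bigraph \<Rightarrow> bigraph" where
  "compose_bigraph k m X Y = {(a, b). (a < k \<and> b < m) \<or> (m \<le> b \<and> (a, b - m) \<in> X) \<or> (k \<le> a \<and> (a - k, b) \<in> Y)}"

definition compose_seq :: "nat \<Rightarrow> nat \<Rightarrow> bideg_seq \<Rightarrow> bideg_seq \<Rightarrow> bideg_seq" where
  "compose_seq k m s t =
     (map (\<lambda>x. x + m) (fst s) @ fst t, map (\<lambda>x. x + k) (snd t) @ snd s)"

lemma mem_compose:
  assumes "X \<subseteq> {..<k} \<times> {..<k}" "Y \<subseteq> {..<m} \<times> {..<m}"
  shows "(a, b) \<in> compose_bigraph k m X Y \<longleftrightarrow>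
    (if a < k then (if b < m then True else (a, b - m) \<in> X) else (if b < m then (a - k, b) \<in> Y else False))"
  using assms by (auto simp: compose_bigraph_def)

lemma compose_subset:
  assumes "X \<subseteq> {..<k} \<times> {..<k}" "Y \<subseteq> {..<m} \<times> {..<m}"
  shows "compose_bigraph k m X Y \<subseteq> {..<k + m} \<times> {..<k + m}"
proof (clarify)
  fix a b assume ab: "(a, b) \<in> compose_bigraph k m X Y"
  then show "a \<in> {..<k + m} \<and> b \<in> {..<k + m}"
    using assms by (force simp: compose_bigraph_def)
qed

lemma compose_Image:
  assumes "X \<subseteq> {..<k} \<times> {..<k}" "Y \<subseteq> {..<m} \<times> {..<m}"
  shows "compose_bigraph k m X Y `` {u} = (if u < k then {..<m} \<union> (\<lambda>v. v + m) ` (X `` {u}) else Y `` {u - k})"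
    and "(compose_bigraph k m X Y)\<inverse> `` {v} = (if v < m then {..<k} \<union> (\<lambda>u. u + k) ` (Y\<inverse> `` {v}) else X\<inverse> `` {v - m})"
proof -
  have img: "(\<lambda>v. v + m) ` S = {v. m \<le> v \<and> v - m \<in> S}" for S and m :: nat
    by (force simp: image_iff)
  show "compose_bigraph k m X Y `` {u} = (if u < k then {..<m} \<union> (\<lambda>v. v + m) ` (X `` {u}) else Y `` {u - k})"
    unfolding img using assms by (auto simp: mem_compose[OF assms] split: if_splits)
  show "(compose_bigraph k m X Y)\<inverse> `` {v} = (if v < m then {..<k} \<union> (\<lambda>u. u + k) ` (Y\<inverse> `` {v}) else X\<inverse> `` {v - m})"
    unfolding img using assms by (auto simp: mem_compose[OF assms] split: if_splits)
qed

lemma card_shifted: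
  fixes m :: nat
  assumes "finite S"
  shows "card ({..<m} \<union> (\<lambda>v. v + m) ` S) = card S + m"
proof -
  have "card ({..<m} \<union> (\<lambda>v. v + m) ` S) = card {..<m} + card ((\<lambda>v. v + m) ` S)"
    by (rule card_Un_disjoint) (use assms in auto)
  then show ?thesis by (simp add: card_image)
qed

lemma compose_degrees:
  assumes "X \<subseteq> {..<k} \<times> {..<k}" "Y \<subseteq> {..<m} \<times> {..<m}"
  shows "card (compose_bigraph k m X Y `` {u}) = (if u < k then card (X `` {u}) + m else card (Y `` {u - k}))"
    and "card ((compose_bigraph k m X Y)\<inverse> `` {v}) = (if v < m then card (Y\<inverse> `` {v}) + k else card (X\<inverse> `` {v - m}))"
proof -
  have "finite X" "finite Y" using assms by (meson finite_SigmaI finite_lessThan finite_subset)+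
  then have "finite (X `` {u})" "finite (Y\<inverse> `` {v})" by (auto intro: finite_Image)
  then show "card (compose_bigraph k m X Y `` {u}) = (if u < k then card (X `` {u}) + m else card (Y `` {u - k}))"
    "card ((compose_bigraph k m X Y)\<inverse> `` {v}) = (if v < m then card (Y\<inverse> `` {v}) + k else card (X\<inverse> `` {v - m}))"
    unfolding compose_Image[OF assms] by (auto simp: card_shifted)
qed

lemma compose_realizations:
  assumes len: "length (fst s) = k" "length (snd s) = k" "length (fst t) = m" "length (snd t) = m"
    and X: "X \<subseteq> {..<k} \<times> {..<k}" and Y: "Y \<subseteq> {..<m} \<times> {..<m}"
  shows "compose_bigraph k m X Y \<in> realizations (k + m) (compose_seq k m s t) \<longleftrightarrow>
    X \<in> realizations k s \<and> Y \<in> realizations m t"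
proof -
  let ?E = "compose_bigraph k m X Y" and ?s = "compose_seq k m s t"
  have split: "(\<forall>i<a + b. P i) \<longleftrightarrow> (\<forall>i<a. P i) \<and> (\<forall>i<b. P (a + i))" for a b :: nat and P
    by (metis add_less_cancel_left le_add_diff_inverse not_less trans_less_add1)
  have row: "(\<forall>u<k + m. card (?E `` {u}) = fst ?s ! u) \<longleftrightarrow>
      (\<forall>u<k. card (X `` {u}) = fst s ! u) \<and> (\<forall>u<m. card (Y `` {u}) = fst t ! u)"
    unfolding split compose_degrees[OF X Y] using len by (simp add: compose_seq_def nth_append)
  have "(\<forall>v<m + k. card (?E\<inverse> `` {v}) = snd ?s ! v) \<longleftrightarrow>
      (\<forall>v<m. card (Y\<inverse> `` {v}) = snd t ! v) \<and> (\<forall>v<k. card (X\<inverse> `` {v}) = snd s ! v)"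
    unfolding split compose_degrees[OF X Y] using len by (simp add: compose_seq_def nth_append)
  then have col: "(\<forall>v<k + m. card (?E\<inverse> `` {v}) = snd ?s ! v) \<longleftrightarrow>
      (\<forall>v<m. card (Y\<inverse> `` {v}) = snd t ! v) \<and> (\<forall>v<k. card (X\<inverse> `` {v}) = snd s ! v)"
    by (simp add: add.commute)
  show ?thesis
    unfolding realizations_iff row col using X Y compose_subset[OF X Y] by blast
qed

lemma sum_card_rows:
  assumes "finite E" "finite A"
  shows "(\<Sum>u\<in>A. card (E `` {u})) = card (E \<inter> A \<times> UNIV)"
proof -
  have "E \<inter> A \<times> UNIV = (SIGMA u:A. E `` {u})" by auto
  then show ?thesis using assms by (simp add: finite_Image)
qed

lemma sum_card_cols:
  assumes "finite E" "finite B"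
  shows "(\<Sum>v\<in>B. card (E\<inverse> `` {v})) = card (E \<inter> UNIV \<times> B)"
proof -
  have "(\<Sum>v\<in>B. card (E\<inverse> `` {v})) = card (E\<inverse> \<inter> B \<times> UNIV)"
    using assms by (simp add: sum_card_rows)
  also have "E\<inverse> \<inter> B \<times> UNIV = (E \<inter> UNIV \<times> B)\<inverse>" by auto
  finally show ?thesis by simp
qed

lemma finite_realization: "E \<in> realizations n s \<Longrightarrow> finite E"
  unfolding realizations_iff by (meson finite_SigmaI finite_lessThan finite_subset)

lemma graphical_sum_eq:
  assumes "graphical n s"
  shows "(\<Sum>u<n. fst s ! u) = (\<Sum>v<n. snd s ! v)"
proof -
  obtain E where E: "E \<in> realizations n s" using assms by (auto simp: graphical_def)
  then have "(\<Sum>u<n. fst s ! u) = (\<Sum>u<n. card (E `` {u}))" "(\<Sum>v<n. snd s ! v) = (\<Sum>v<n. card (E\<inverse> `` {v}))"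
    by (simp_all add: realizations_iff)
  moreover have "E \<inter> {..<n} \<times> UNIV = E" "E \<inter> UNIV \<times> {..<n} = E"
    using E by (auto simp: realizations_iff)
  ultimately show ?thesis using finite_realization[OF E] sum_card_rows[of E "{..<n}"] by (simp add: sum_card_cols)
qed

text \<open>Counting edges at the left vertices below \<open>k\<close> and at the right vertices from \<open>m\<close> on shows
  that the degrees force the complete block to be full and the opposite block to be empty.\<close>

lemma realizations_compose_split:
  assumes len: "length (fst s) = k" "length (snd s) = k" "length (fst t) = m" "length (snd t) = m"
    and s: "graphical k s"
    and E: "E \<in> realizations (k + m) (compose_seq k m s t)"
  shows "\<exists>X Y. X \<subseteq> {..<k} \<times> {..<k} \<and> Y \<subseteq> {..<m} \<times> {..<m} \<and> E = compose_bigraph k m X Y"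
proof -
  have sub: "E \<subseteq> {..<k + m} \<times> {..<k + m}" using E by (simp add: realizations_iff)
  have fin: "finite E" using finite_realization[OF E] .
  define E12 where "E12 = E \<inter> {..<k} \<times> {..<m}"
  define E11 where "E11 = E \<inter> {..<k} \<times> {m..<k + m}"
  define E21 where "E21 = E \<inter> {k..<k + m} \<times> {m..<k + m}"
  have finE: "finite E12" "finite E11" "finite E21" using fin by (auto simp: E12_def E11_def E21_def)
  have "card E12 + card E11 = card (E12 \<union> E11)"
    by (rule card_Un_disjoint[symmetric]) (use finE in \<open>auto simp: E12_def E11_def\<close>)
  also have "E12 \<union> E11 = E \<inter> {..<k} \<times> UNIV"
    using sub by (auto simp: E12_def E11_def)
  also have "card \<dots> = (\<Sum>u<k. card (E `` {u}))" using fin by (simp add: sum_card_rows)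
  also have "\<dots> = (\<Sum>u<k. fst s ! u + m)"
    using E len by (intro sum.cong refl) (simp add: realizations_iff compose_seq_def nth_append)
  also have "\<dots> = (\<Sum>u<k. fst s ! u) + k * m" by (simp add: sum.distrib)
  finally have 1: "card E12 + card E11 = (\<Sum>u<k. fst s ! u) + k * m" .
  have "card E11 + card E21 = card (E11 \<union> E21)"
    by (rule card_Un_disjoint[symmetric]) (use finE in \<open>auto simp: E21_def E11_def\<close>)
  also have "E11 \<union> E21 = E \<inter> UNIV \<times> {m..<k + m}"
    using sub by (auto simp: E21_def E11_def)
  also have "card \<dots> = (\<Sum>v\<in>{m..<k + m}. card (E\<inverse> `` {v}))" using fin by (simp add: sum_card_cols)
  also have "\<dots> = (\<Sum>v\<in>{m..<k + m}. snd s ! (v - m))"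
    using E len by (intro sum.cong refl) (simp add: realizations_iff compose_seq_def nth_append)
  also have "\<dots> = (\<Sum>v<k. snd s ! v)"
    by (simp add: sum.shift_bounds_nat_ivl[of _ 0 m k, simplified] lessThan_atLeast0)
  finally have 2: "card E11 + card E21 = (\<Sum>u<k. fst s ! u)" using graphical_sum_eq[OF s] by simp
  have E12_le: "card E12 \<le> k * m"
    using card_mono[of "{..<k} \<times> {..<m}" E12] by (simp add: E12_def)
  \<comment> \<open>Subtracting the two edge counts gives card E12 = k * m + card E21, whereas
    \<open>E12\<close> has room for at most k * m edges.\<close>
  then have c: "card E12 = k * m" "card E21 = 0" using 1 2 by linarith+
  have full: "E12 = {..<k} \<times> {..<m}"
    by (rule card_subset_eq, simp, simp add: E12_def, simp add: c)
  have empty: "E21 = {}" using c(2) finE by simp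
  define X where "X = {(a, b). a < k \<and> (a, b + m) \<in> E}"
  define Y where "Y = {(a, b). b < m \<and> (a + k, b) \<in> E}"
  have X: "X \<subseteq> {..<k} \<times> {..<k}" and Y: "Y \<subseteq> {..<m} \<times> {..<m}"
    using sub by (auto simp: X_def Y_def)
  have "(a, b) \<in> E \<longleftrightarrow> (a, b) \<in> compose_bigraph k m X Y" for a b
  proof -
    have "a < k \<Longrightarrow> b < m \<Longrightarrow> (a, b) \<in> E" using full by (auto simp: E12_def)
    moreover have "\<not> a < k \<Longrightarrow> \<not> b < m \<Longrightarrow> (a, b) \<notin> E" using empty sub unfolding E21_def by fastforce
    ultimately show ?thesis unfolding mem_compose[OF X Y] by (auto simp: X_def Y_def)
  qed
  then have "E = compose_bigraph k m X Y" by auto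
  then show ?thesis using X Y by blast
qed

lemma compose_inject:
  assumes "X \<subseteq> {..<k} \<times> {..<k}" "Y \<subseteq> {..<m} \<times> {..<m}" "X' \<subseteq> {..<k} \<times> {..<k}" "Y' \<subseteq> {..<m} \<times> {..<m}"
    and eq: "compose_bigraph k m X Y = compose_bigraph k m X' Y'"
  shows "X = X' \<and> Y = Y'"
proof -
  have "(a, b) \<in> X \<longleftrightarrow> (a, b) \<in> X'" for a b
  proof (cases "a < k")
    case True
    then have "(a, b) \<in> X \<longleftrightarrow> (a, b + m) \<in> compose_bigraph k m X Y" "(a, b) \<in> X' \<longleftrightarrow> (a, b + m) \<in> compose_bigraph k m X' Y'"
      unfolding mem_compose[OF assms(1,2)] mem_compose[OF assms(3,4)] by auto
    then show ?thesis using eq by simp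
  qed (use assms in auto)
  moreover have "(a, b) \<in> Y \<longleftrightarrow> (a, b) \<in> Y'" for a b
  proof (cases "b < m")
    case True
    then have "(a, b) \<in> Y \<longleftrightarrow> (a + k, b) \<in> compose_bigraph k m X Y" "(a, b) \<in> Y' \<longleftrightarrow> (a + k, b) \<in> compose_bigraph k m X' Y'"
      unfolding mem_compose[OF assms(1,2)] mem_compose[OF assms(3,4)] by auto
    then show ?thesis using eq by simp
  qed (use assms in auto)
  ultimately show ?thesis by auto
qed

text \<open>Surjectivity is the forced block structure; within that structure the degree conditions
  decouple into those of the two factors. This makes the state space a product.\<close>

lemma bij_betw_compose:
  assumes len: "length (fst s) = k" "length (snd s) = k" "length (fst t) = m" "length (snd t) = m"
    and s: "graphical k s"
  shows "bij_betw (\<lambda>(X, Y). compose_bigraph k m X Y) (realizations k s \<times> realizations m t)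
    (realizations (k + m) (compose_seq k m s t))"
proof (rule bij_betwI')
  fix x y assume "x \<in> realizations k s \<times> realizations m t" "y \<in> realizations k s \<times> realizations m t"
  then show "((\<lambda>(X, Y). compose_bigraph k m X Y) x = (\<lambda>(X, Y). compose_bigraph k m X Y) y) = (x = y)"
    using compose_inject[of "fst x" k "snd x" m "fst y" "snd y"]
    by (auto simp: realizations_iff)
next
  fix x assume "x \<in> realizations k s \<times> realizations m t"
  then show "(\<lambda>(X, Y). compose_bigraph k m X Y) x \<in> realizations (k + m) (compose_seq k m s t)"
    using compose_realizations[OF len, of "fst x" "snd x"] by (auto simp: realizations_iff[of _ k] realizations_iff[of _ m])
next
  fix E assume E: "E \<in> realizations (k + m) (compose_seq k m s t)"
  then obtain X Y where XY: "X \<subseteq> {..<k} \<times> {..<k}" "Y \<subseteq> {..<m} \<times> {..<m}" "E = compose_bigraph k m X Y"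
    using realizations_compose_split[OF len s] by blast
  then show "\<exists>x\<in>realizations k s \<times> realizations m t. E = (\<lambda>(X, Y). compose_bigraph k m X Y) x"
    using E compose_realizations[OF len XY(1,2)] by auto
qed

section \<open>Swaps inside a factor and tensorization of the Poincare inequality\<close>

definition emb_fst :: "nat \<Rightarrow> nat \<times> nat \<times> nat \<times> nat \<Rightarrow> nat \<times> nat \<times> nat \<times> nat" where
  "emb_fst m = (\<lambda>(a, b, c, d). (a, b, c + m, d + m))"

text \<open>Left indices shift here and right indices in \<open>emb_fst\<close>, because the two
  factors are listed in opposite orders in the two vertex classes.\<close>

definition emb_snd :: "nat \<Rightarrow> nat \<times> nat \<times> nat \<times> nat \<Rightarrow> nat \<times> nat \<times> nat \<times> nat" where
  "emb_snd k = (\<lambda>(a, b, c, d). (a + k, b + k, c, d))"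

lemma try_swap_subset:
  assumes "G \<subseteq> A \<times> V"
  shows "try_swap q G \<subseteq> A \<times> V"
  using try_swap_cases[of q G]
proof
  assume "swap_adj G (try_swap q G)"
  from swap_adj_subset[OF this assms] show ?thesis .
qed (use assms in simp)

text \<open>All four pairs that the shifted choice inspects lie in the block carrying
  \<open>X\<close>, so it is accepted in the composition exactly when the original is accepted in
  \<open>X\<close>, and it leaves the other blocks alone.\<close>

lemma try_swap_emb_fst:
  assumes X: "X \<subseteq> {..<k} \<times> {..<k}" and Y: "Y \<subseteq> {..<m} \<times> {..<m}" and q: "q \<in> swap_choices k"
  shows "try_swap (emb_fst m q) (compose_bigraph k m X Y) = compose_bigraph k m (try_swap q X) Y"
proof -
  obtain a b c d where q': "q = (a, b, c, d)" by (cases q)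
  then have lt: "a < k" "b < k" "c < k" "d < k" using q by (auto simp: swap_choices_def)
  have mem: "(a, c + m) \<in> compose_bigraph k m X Y \<longleftrightarrow> (a, c) \<in> X" if "a < k" for a c
    unfolding mem_compose[OF X Y] using that by simp
  show ?thesis
  proof (cases "(a, c) \<in> X \<and> (b, d) \<in> X \<and> (b, c) \<notin> X \<and> (a, d) \<notin> X")
    case True
    then have X': "try_swap q X = (X - {(a, c), (b, d)}) \<union> {(b, c), (a, d)}"
      and l: "try_swap (emb_fst m q) (compose_bigraph k m X Y) =
        (compose_bigraph k m X Y - {(a, c + m), (b, d + m)}) \<union> {(b, c + m), (a, d + m)}"
      using lt by (auto simp: q' try_swap_def emb_fst_def mem)
    have sub: "try_swap q X \<subseteq> {..<k} \<times> {..<k}" using try_swap_subset[OF X] .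
    have shift: "(x, y) = (x', z + m) \<longleftrightarrow> m \<le> y \<and> (x, y - m) = (x', z)" for x y x' z by auto
    have "(x, y) \<in> try_swap (emb_fst m q) (compose_bigraph k m X Y) \<longleftrightarrow> (x, y) \<in> compose_bigraph k m (try_swap q X) Y" for x y
      unfolding l mem_compose[OF sub Y] unfolding X' Un_iff Diff_iff insert_iff empty_iff shift
        mem_compose[OF X Y] using lt by auto
    then show ?thesis by auto
  next
    case False
    then show ?thesis using lt by (auto simp: q' try_swap_def emb_fst_def mem)
  qed
qed

lemma try_swap_emb_snd:
  assumes X: "X \<subseteq> {..<k} \<times> {..<k}" and Y: "Y \<subseteq> {..<m} \<times> {..<m}" and q: "q \<in> swap_choices m"
  shows "try_swap (emb_snd k q) (compose_bigraph k m X Y) = compose_bigraph k m X (try_swap q Y)"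
proof -
  obtain a b c d where q': "q = (a, b, c, d)" by (cases q)
  then have lt: "a < m" "b < m" "c < m" "d < m" using q by (auto simp: swap_choices_def)
  have mem: "(a + k, c) \<in> compose_bigraph k m X Y \<longleftrightarrow> (a, c) \<in> Y" if "c < m" for a c
    unfolding mem_compose[OF X Y] using that by simp
  show ?thesis
  proof (cases "(a, c) \<in> Y \<and> (b, d) \<in> Y \<and> (b, c) \<notin> Y \<and> (a, d) \<notin> Y")
    case True
    then have Y': "try_swap q Y = (Y - {(a, c), (b, d)}) \<union> {(b, c), (a, d)}"
      and l: "try_swap (emb_snd k q) (compose_bigraph k m X Y) =
        (compose_bigraph k m X Y - {(a + k, c), (b + k, d)}) \<union> {(b + k, c), (a + k, d)}"
      using lt by (auto simp: q' try_swap_def emb_snd_def mem)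
    have sub: "try_swap q Y \<subseteq> {..<m} \<times> {..<m}" using try_swap_subset[OF Y] .
    have shift: "(x, y) = (x' + k, z) \<longleftrightarrow> k \<le> x \<and> (x - k, y) = (x', z)" for x y x' z by auto
    have "(x, y) \<in> try_swap (emb_snd k q) (compose_bigraph k m X Y) \<longleftrightarrow> (x, y) \<in> compose_bigraph k m X (try_swap q Y)" for x y
      unfolding l mem_compose[OF X sub] unfolding Y' Un_iff Diff_iff insert_iff empty_iff shift
        mem_compose[OF X Y] using lt by auto
    then show ?thesis by auto
  next
    case False
    then show ?thesis using lt by (auto simp: q' try_swap_def emb_snd_def mem)
  qed
qed

text \<open>The two embeddings are injective with disjoint images, separated by whether the left
  vertices lie below \<open>k\<close>. Choices that mix the factors are discarded, at the expense of
  non-negative terms only.\<close>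

lemma sum_swap_choices_compose:
  fixes h :: "nat \<times> nat \<times> nat \<times> nat \<Rightarrow> real"
  assumes "\<And>q. h q \<ge> 0"
  shows "(\<Sum>q\<in>swap_choices k. h (emb_fst m q)) + (\<Sum>q\<in>swap_choices m. h (emb_snd k q))
    \<le> (\<Sum>q\<in>swap_choices (k + m). h q)"
proof -
  have inj: "inj_on (emb_fst m) S" "inj_on (emb_snd k) S" for S
    by (auto simp: inj_on_def emb_fst_def emb_snd_def)
  have "(\<Sum>q\<in>swap_choices k. h (emb_fst m q)) + (\<Sum>q\<in>swap_choices m. h (emb_snd k q)) =
      (\<Sum>q\<in>emb_fst m ` swap_choices k. h q) + (\<Sum>q\<in>emb_snd k ` swap_choices m. h q)"
    by (simp add: sum.reindex inj)
  also have "\<dots> = (\<Sum>q\<in>emb_fst m ` swap_choices k \<union> emb_snd k ` swap_choices m. h q)"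
    by (rule sum.union_disjoint[symmetric], simp, simp, auto simp: emb_fst_def emb_snd_def swap_choices_def)
  also have "\<dots> \<le> (\<Sum>q\<in>swap_choices (k + m). h q)"
    by (rule sum_mono2, simp, auto simp: assms emb_fst_def emb_snd_def swap_choices_def)
  finally show ?thesis .
qed

text \<open>Pointwise, this is the quadrilateral inequality: the squared diagonals are bounded by
  the squared sides.\<close>

lemma sum_pairwise_diff_squares_product:
  fixes g :: "'a \<Rightarrow> 'b \<Rightarrow> real"
  shows "(\<Sum>x\<in>A. \<Sum>y\<in>B. \<Sum>x'\<in>A. \<Sum>y'\<in>B. (g x y - g x' y')\<^sup>2)
    \<le> real (card A) * (\<Sum>x\<in>A. \<Sum>y\<in>B. \<Sum>y'\<in>B. (g x y - g x y')\<^sup>2) +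
      real (card B) * (\<Sum>y\<in>B. \<Sum>x\<in>A. \<Sum>x'\<in>A. (g x y - g x' y)\<^sup>2)"
proof -
  let ?S = "\<lambda>F. \<Sum>x\<in>A. \<Sum>y\<in>B. \<Sum>x'\<in>A. \<Sum>y'\<in>B. F x y x' y'"
  have pt: "(g x y - g x' y')\<^sup>2 + (g x y' - g x' y)\<^sup>2 \<le>
      ((g x y - g x y')\<^sup>2 + (g x' y - g x' y')\<^sup>2) + ((g x y - g x' y)\<^sup>2 + (g x y' - g x' y')\<^sup>2)"
    for x y x' y'
  proof -
    have "0 \<le> (g x y - g x y' - g x' y + g x' y')\<^sup>2" by simp
    then show ?thesis by (simp add: power2_eq_square algebra_simps)
  qed
  have "?S (\<lambda>x y x' y'. (g x y - g x' y')\<^sup>2) + ?S (\<lambda>x y x' y'. (g x y' - g x' y)\<^sup>2)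
    \<le> (?S (\<lambda>x y x' y'. (g x y - g x y')\<^sup>2) + ?S (\<lambda>x y x' y'. (g x' y - g x' y')\<^sup>2)) +
      (?S (\<lambda>x y x' y'. (g x y - g x' y)\<^sup>2) + ?S (\<lambda>x y x' y'. (g x y' - g x' y')\<^sup>2))"
    unfolding sum.distrib[symmetric] by (intro sum_mono pt)
  \<comment> \<open>Exchanging y and y' carries one diagonal to the other, so the left side is twice
    the wanted sum. Opposite sides also have equal totals, and the common factor 2 cancels.\<close>
  moreover have "?S (\<lambda>x y x' y'. (g x y' - g x' y)\<^sup>2) = ?S (\<lambda>x y x' y'. (g x y - g x' y')\<^sup>2)"
  proof -
    have "(\<Sum>y\<in>B. \<Sum>x'\<in>A. \<Sum>y'\<in>B. (g x y' - g x' y)\<^sup>2) = (\<Sum>y\<in>B. \<Sum>x'\<in>A. \<Sum>y'\<in>B. (g x y - g x' y')\<^sup>2)" for x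
    proof -
      have "(\<Sum>y\<in>B. \<Sum>x'\<in>A. \<Sum>y'\<in>B. (g x y' - g x' y)\<^sup>2) = (\<Sum>x'\<in>A. \<Sum>y\<in>B. \<Sum>y'\<in>B. (g x y' - g x' y)\<^sup>2)"
        by (rule sum.swap)
      also have "\<dots> = (\<Sum>x'\<in>A. \<Sum>y'\<in>B. \<Sum>y\<in>B. (g x y' - g x' y)\<^sup>2)"
        by (intro sum.cong refl sum.swap)
      also have "\<dots> = (\<Sum>y'\<in>B. \<Sum>x'\<in>A. \<Sum>y\<in>B. (g x y' - g x' y)\<^sup>2)"
        by (rule sum.swap)
      finally show ?thesis .
    qed
    then show ?thesis by simp
  qed
  moreover have "?S (\<lambda>x y x' y'. (g x y - g x y')\<^sup>2) =
      real (card A) * (\<Sum>x\<in>A. \<Sum>y\<in>B. \<Sum>y'\<in>B. (g x y - g x y')\<^sup>2)"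
    by (simp add: sum_distrib_left)
  moreover have "?S (\<lambda>x y x' y'. (g x' y - g x' y')\<^sup>2) =
      real (card A) * (\<Sum>x\<in>A. \<Sum>y\<in>B. \<Sum>y'\<in>B. (g x y - g x y')\<^sup>2)"
    using sum.swap[of "\<lambda>y x'. \<Sum>y'\<in>B. (g x' y - g x' y')\<^sup>2" A B] by simp
  moreover have "?S (\<lambda>x y x' y'. (g x y - g x' y)\<^sup>2) =
      real (card B) * (\<Sum>y\<in>B. \<Sum>x\<in>A. \<Sum>x'\<in>A. (g x y - g x' y)\<^sup>2)"
    using sum.swap[of "\<lambda>x y. \<Sum>x'\<in>A. (g x y - g x' y)\<^sup>2" B A]
    by (simp add: sum_distrib_left[symmetric])
  moreover have "?S (\<lambda>x y x' y'. (g x y' - g x' y')\<^sup>2) =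
      real (card B) * (\<Sum>y\<in>B. \<Sum>x\<in>A. \<Sum>x'\<in>A. (g x y - g x' y)\<^sup>2)"
  proof -
    have "?S (\<lambda>x y x' y'. (g x y' - g x' y')\<^sup>2) = real (card B) * (\<Sum>x\<in>A. \<Sum>x'\<in>A. \<Sum>y\<in>B. (g x y - g x' y)\<^sup>2)"
      by (simp add: sum_distrib_left[symmetric])
    also have "(\<Sum>x\<in>A. \<Sum>x'\<in>A. \<Sum>y\<in>B. (g x y - g x' y)\<^sup>2) = (\<Sum>x\<in>A. \<Sum>y\<in>B. \<Sum>x'\<in>A. (g x y - g x' y)\<^sup>2)"
      by (intro sum.cong refl sum.swap)
    also have "\<dots> = (\<Sum>y\<in>B. \<Sum>x\<in>A. \<Sum>x'\<in>A. (g x y - g x' y)\<^sup>2)" by (rule sum.swap)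
    finally show ?thesis .
  qed
  ultimately show ?thesis by linarith
qed

text \<open>The pair sum is bounded by pair sums along the fibres of the product, to which the
  inequalities of the factors apply. In both directions the resulting weight is \<open>K\<close>
  times the product of the two numbers of realizations, which is exactly the weight wanted for the
  composition, and the fibrewise Dirichlet forms add up to at most the whole one.\<close>

lemma poincare_compose:
  assumes len: "length (fst s) = k" "length (snd s) = k" "length (fst t) = m" "length (snd t) = m"
    and s: "graphical k s" and K: "K \<ge> 0" and PI: "poincare K k s" "poincare K m t"
  shows "poincare K (k + m) (compose_seq k m s t)"
  unfolding poincare_def
proof
  fix f :: "bigraph \<Rightarrow> real"
  let ?A = "realizations k s" and ?B = "realizations m t"
  let ?R = "realizations (k + m) (compose_seq k m s t)"
  define g where "g X Y = f (compose_bigraph k m X Y)" for X Y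
  note bij = bij_betw_compose[OF len s]
  have re: "(\<Sum>G\<in>?R. h G) = (\<Sum>X\<in>?A. \<Sum>Y\<in>?B. h (compose_bigraph k m X Y))" for h :: "bigraph \<Rightarrow> real"
    unfolding sum.reindex_bij_betw[OF bij, symmetric] by (simp add: sum.cartesian_product split_beta)
  have card: "card ?R = card ?A * card ?B"
    using bij_betw_same_card[OF bij] by (simp add: card_cartesian_product)
  define D1 where "D1 = (\<Sum>Y\<in>?B. dirichlet k s (\<lambda>X. g X Y))"
  define D2 where "D2 = (\<Sum>X\<in>?A. dirichlet m t (\<lambda>Y. g X Y))"
  have D: "D1 + D2 \<le> dirichlet (k + m) (compose_seq k m s t) f"
  proof -
    have "D1 + D2 = (\<Sum>X\<in>?A. \<Sum>Y\<in>?B. (\<Sum>q\<in>swap_choices k. (g (try_swap q X) Y - g X Y)\<^sup>2) +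
        (\<Sum>q\<in>swap_choices m. (g X (try_swap q Y) - g X Y)\<^sup>2))"
      unfolding D1_def D2_def dirichlet_def sum.distrib by (subst sum.swap) simp
    also have "\<dots> \<le> (\<Sum>X\<in>?A. \<Sum>Y\<in>?B. \<Sum>q\<in>swap_choices (k + m).
        (f (try_swap q (compose_bigraph k m X Y)) - f (compose_bigraph k m X Y))\<^sup>2)"
    proof (intro sum_mono)
      fix X Y assume "X \<in> ?A" "Y \<in> ?B"
      then have X: "X \<subseteq> {..<k} \<times> {..<k}" and Y: "Y \<subseteq> {..<m} \<times> {..<m}" by (simp_all add: realizations_iff)
      show "(\<Sum>q\<in>swap_choices k. (g (try_swap q X) Y - g X Y)\<^sup>2) +
        (\<Sum>q\<in>swap_choices m. (g X (try_swap q Y) - g X Y)\<^sup>2) \<le>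
        (\<Sum>q\<in>swap_choices (k + m). (f (try_swap q (compose_bigraph k m X Y)) - f (compose_bigraph k m X Y))\<^sup>2)"
        using sum_swap_choices_compose[of "\<lambda>q. (f (try_swap q (compose_bigraph k m X Y)) - f (compose_bigraph k m X Y))\<^sup>2" m k]
        by (simp add: g_def try_swap_emb_fst[OF X Y] try_swap_emb_snd[OF X Y])
    qed
    also have "\<dots> = dirichlet (k + m) (compose_seq k m s t) f"
      unfolding dirichlet_def by (rule re[symmetric])
    finally show ?thesis .
  qed
  have "(\<Sum>G\<in>?R. \<Sum>H\<in>?R. (f G - f H)\<^sup>2) = (\<Sum>X\<in>?A. \<Sum>Y\<in>?B. \<Sum>X'\<in>?A. \<Sum>Y'\<in>?B. (g X Y - g X' Y')\<^sup>2)"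
    by (simp add: re g_def)
  also have "\<dots> \<le> real (card ?A) * (\<Sum>X\<in>?A. \<Sum>Y\<in>?B. \<Sum>Y'\<in>?B. (g X Y - g X Y')\<^sup>2) +
      real (card ?B) * (\<Sum>Y\<in>?B. \<Sum>X\<in>?A. \<Sum>X'\<in>?A. (g X Y - g X' Y)\<^sup>2)"
    by (rule sum_pairwise_diff_squares_product)
  also have "\<dots> \<le> real (card ?A) * (\<Sum>X\<in>?A. K * real (card ?B) * dirichlet m t (\<lambda>Y. g X Y)) +
      real (card ?B) * (\<Sum>Y\<in>?B. K * real (card ?A) * dirichlet k s (\<lambda>X. g X Y))"
    using PI unfolding poincare_def by (intro add_mono mult_left_mono sum_mono) auto
  also have "\<dots> = K * real (card ?R) * (D1 + D2)"
    by (simp add: D1_def D2_def card sum_distrib_left algebra_simps)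
  also have "\<dots> \<le> K * real (card ?R) * dirichlet (k + m) (compose_seq k m s t) f"
    using D K by (intro mult_left_mono) auto
  finally show "(\<Sum>G\<in>?R. \<Sum>H\<in>?R. (f G - f H)\<^sup>2)
    \<le> K * real (card ?R) * dirichlet (k + m) (compose_seq k m s t) f" .
qed

section \<open>Relaxation time and counting\<close>

lemma pmf_swap_step:
  assumes "n \<ge> 2"
  shows "pmf (swap_step n G) H = (if G = H then 1 / 2 else 0) +
    real (card {q \<in> swap_choices n. try_swap q G = H}) / (2 * real (card (swap_choices n)))"
proof -
  have "(0, 1, 0, 1) \<in> swap_choices n" using assms by (simp add: swap_choices_def)
  then have ne: "swap_choices n \<noteq> {}" by blast
  have "swap_choices n \<inter> (\<lambda>q. try_swap q G) -` {H} = {q \<in> swap_choices n. try_swap q G = H}" by auto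
  then show ?thesis
    using assms ne by (simp add: swap_step_def pmf_bind pmf_map measure_pmf_of_set)
qed

lemma swap_choices_nonempty: "n \<ge> 2 \<Longrightarrow> card (swap_choices n) > 0"
proof -
  assume "n \<ge> 2"
  then have "(0, 1, 0, 1) \<in> swap_choices n" by (simp add: swap_choices_def)
  then show ?thesis by (auto simp: card_gt_0_iff)
qed

lemma card_swap_choices_le: "card (swap_choices n) \<le> n ^ 4"
proof -
  have "card (swap_choices n) \<le> card ({..<n} \<times> {..<n} \<times> {..<n} \<times> {..<n})"
    by (rule card_mono) (auto simp: swap_choices_def)
  then show ?thesis by (simp add: card_cartesian_product power4_eq_xxxx mult.assoc)
qed

text \<open>After a swap at (a, b, c, d) the edges are bc and ad, so exchanging only the two left
  vertices yields the choice that undoes it.\<close>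

definition reverse_choice :: "nat \<times> nat \<times> nat \<times> nat \<Rightarrow> nat \<times> nat \<times> nat \<times> nat" where
  "reverse_choice = (\<lambda>(a, b, c, d). (b, a, c, d))"

lemma reverse_choice_swap_choices: "q \<in> swap_choices n \<Longrightarrow> reverse_choice q \<in> swap_choices n"
  by (auto simp: swap_choices_def reverse_choice_def)

lemma reverse_choice_reverse_choice [simp]: "reverse_choice (reverse_choice q) = q"
  by (auto simp: reverse_choice_def split: prod.splits)

lemma try_swap_reverse_choice:
  assumes "q \<in> swap_choices n" "try_swap q G \<noteq> G"
  shows "try_swap (reverse_choice q) (try_swap q G) = G"
proof -
  obtain a b c d where q: "q = (a, b, c, d)" by (cases q)
  then have ne: "a \<noteq> b" "c \<noteq> d" using assms(1) by (auto simp: swap_choices_def)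
  have *: "(a, c) \<in> G" "(b, d) \<in> G" "(b, c) \<notin> G" "(a, d) \<notin> G"
    using assms(2) by (auto simp: q try_swap_def split: if_splits)
  then show ?thesis using ne by (auto simp: q try_swap_def reverse_choice_def)
qed

text \<open>Reversal matches the choices leading from \<open>G\<close> to \<open>H\<close> with
  those leading back, which makes the transition matrix symmetric. The case G = H is separate: the
  reverse of a rejected choice may be accepted.\<close>

lemma card_choices_sym:
  "card {q \<in> swap_choices n. try_swap q G = H} = card {q \<in> swap_choices n. try_swap q H = G}"
proof (cases "G = H")
  case False
  have sub: "reverse_choice ` {q \<in> swap_choices n. try_swap q G = H} \<subseteq> {q \<in> swap_choices n. try_swap q H = G}"
    if "G \<noteq> H" for G H
  proof (rule image_subsetI)
    fix q assume q: "q \<in> {q \<in> swap_choices n. try_swap q G = H}"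
    with that have "try_swap q G \<noteq> G" by auto
    with q show "reverse_choice q \<in> {q \<in> swap_choices n. try_swap q H = G}"
      using reverse_choice_swap_choices[of q n] try_swap_reverse_choice[of q n G] by auto
  qed
  show ?thesis
    by (rule bij_betw_same_card[of reverse_choice],
        rule bij_betw_byWitness[of _ reverse_choice, OF _ _ sub[OF False] sub[OF False[symmetric]]]) simp_all
qed simp

text \<open>The assumption on \<open>h\<close> removes the holding probability from the sum. It is
  met by the squared differences of the Dirichlet form; the 2 in the denominator is the cost of
  laziness.\<close>

lemma sum_pmf_swap_step:
  assumes n: "n \<ge> 2" and G: "G \<in> realizations n s" and h: "h G = 0"
  shows "(\<Sum>H\<in>realizations n s. pmf (swap_step n G) H * h H) =
    (\<Sum>q\<in>swap_choices n. h (try_swap q G)) / (2 * real (card (swap_choices n)))"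
proof -
  let ?R = "realizations n s" and ?S = "swap_choices n"
  let ?c = "2 * real (card ?S)"
  have "(\<Sum>H\<in>?R. pmf (swap_step n G) H * h H) =
      (\<Sum>H\<in>?R. real (card {q \<in> ?S. try_swap q G = H}) * h H / ?c)"
    by (intro sum.cong refl) (auto simp: pmf_swap_step[OF n] h)
  also have "\<dots> = (\<Sum>H\<in>?R. (\<Sum>q\<in>{q \<in> ?S. try_swap q G = H}. h (try_swap q G))) / ?c"
  proof -
    have "(\<Sum>q\<in>{q \<in> ?S. try_swap q G = H}. h (try_swap q G)) =
        real (card {q \<in> ?S. try_swap q G = H}) * h H" for H
    proof -
      have "(\<Sum>q\<in>{q \<in> ?S. try_swap q G = H}. h (try_swap q G)) = (\<Sum>q\<in>{q \<in> ?S. try_swap q G = H}. h H)"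
        by (rule sum.cong) auto
      then show ?thesis by simp
    qed
    then show ?thesis by (simp only: sum_divide_distrib)
  qed
  also have "(\<Sum>H\<in>?R. (\<Sum>q\<in>{q \<in> ?S. try_swap q G = H}. h (try_swap q G))) = (\<Sum>q\<in>?S. h (try_swap q G))"
    by (rule sum.group, simp, simp, rule image_subsetI, rule try_swap_realizations[OF G])
  finally show ?thesis .
qed

lemma sum_pmf_swap_step_eq_1:
  assumes G: "G \<in> realizations n s"
  shows "(\<Sum>H\<in>realizations n s. pmf (swap_step n G) H) = 1"
proof (rule sum_pmf_eq_1)
  show "set_pmf (swap_step n G) \<subseteq> realizations n s"
  proof (cases "n < 2")
    case False
    then have ne: "swap_choices n \<noteq> {}" using swap_choices_nonempty[of n] by auto
    have "try_swap q G \<in> realizations n s" for q by (rule try_swap_realizations[OF G])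
    then show ?thesis using G False
      by (auto simp: swap_step_def set_pmf_of_set[OF ne] split: if_splits)
  qed (use G in \<open>simp add: swap_step_def\<close>)
qed simp

text \<open>Without choices the Dirichlet form vanishes, and the indicator function of one
  realization would violate the inequality if there were another. This settles n < 2.\<close>

lemma poincare_unique_realization:
  assumes "poincare K n s" "graphical n s" "swap_choices n = {}"
  shows "card (realizations n s) = 1"
proof -
  let ?R = "realizations n s"
  obtain G where G: "G \<in> ?R" using assms(2) by (auto simp: graphical_def)
  have "H = G" if H: "H \<in> ?R" for H
  proof (rule ccontr)
    assume "H \<noteq> G"
    define f :: "bigraph \<Rightarrow> real" where "f = (\<lambda>X. if X = G then 1 else 0)"
    have "1 = (f G - f H)\<^sup>2" using \<open>H \<noteq> G\<close> by (simp add: f_def)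
    also have "\<dots> \<le> (\<Sum>H\<in>?R. (f G - f H)\<^sup>2)" by (rule member_le_sum) (use H in auto)
    also have "\<dots> \<le> (\<Sum>G\<in>?R. \<Sum>H\<in>?R. (f G - f H)\<^sup>2)"
      by (rule member_le_sum[of G _ "\<lambda>G. \<Sum>H\<in>?R. (f G - f H)\<^sup>2"]) (use G in \<open>auto intro: sum_nonneg\<close>)
    also have "\<dots> \<le> K * real (card ?R) * dirichlet n s f" using assms(1) by (simp add: poincare_def)
    also have "\<dots> = 0" by (simp add: dirichlet_def assms(3))
    finally show False by simp
  qed
  then have "?R = {G}" using G by blast
  then show ?thesis by simp
qed

text \<open>The Dirichlet form of the matrix is \<open>dirichlet\<close> divided by twice the number
  of choices: the 2 comes from laziness and the number of choices from the uniform proposal. Hence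
  the value of \<gamma>.\<close>

lemma second_eigenvalue_transition_matrix:
  assumes n: "n \<ge> 2" and R: "card (realizations n s) \<ge> 2" and K: "K > 0" "poincare K n s"
  shows "eigenvalue_list (transition_matrix n s) ! 1 \<le> 1 - 1 / (2 * K * real (card (swap_choices n)))"
proof -
  let ?R = "realizations n s" and ?S = "swap_choices n"
  define Gs where "Gs = (SOME Gs. distinct Gs \<and> set Gs = ?R)"
  have "\<exists>Gs. distinct Gs \<and> set Gs = ?R" using finite_distinct_list[OF finite_realizations] by blast
  then have Gs: "distinct Gs" "set Gs = ?R" unfolding Gs_def by (metis (mono_tags, lifting) someI_ex)+
  define N where "N = length Gs"
  have N: "N = card ?R" using Gs distinct_card[of Gs] by (simp add: N_def)
  define A where "A = mat N N (\<lambda>(i, j). pmf (swap_step n (Gs ! i)) (Gs ! j))"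
  have A: "transition_matrix n s = A"
    unfolding transition_matrix_def A_def Gs_def N_def Let_def ..
  have bij: "bij_betw (\<lambda>i. Gs ! i) {..<N} ?R"
    using bij_betw_nth[of Gs "{..<N}" ?R] Gs N_def by auto
  have mem: "Gs ! i \<in> ?R" if "i < N" for i using that Gs(2) N_def nth_mem by blast
  have reindex: "(\<Sum>i<N. \<Sum>j<N. h (Gs ! i) (Gs ! j)) = (\<Sum>G\<in>?R. \<Sum>H\<in>?R. h G H)"
    for h :: "bigraph \<Rightarrow> bigraph \<Rightarrow> real"
  proof -
    have "(\<Sum>j<N. h G (Gs ! j)) = (\<Sum>H\<in>?R. h G H)" for G by (rule sum.reindex_bij_betw[OF bij])
    then show ?thesis using sum.reindex_bij_betw[OF bij, of "\<lambda>G. \<Sum>H\<in>?R. h G H"] by simp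
  qed
  have S: "card ?S > 0" using swap_choices_nonempty[OF n] .
  let ?\<gamma> = "1 / (2 * K * real (card ?S))"
  have "eigenvalue_list A ! 1 \<le> 1 - ?\<gamma>"
  proof (rule second_eigenvalue_le_of_poincare[of A N])
    show "A \<in> carrier_mat N N" "N \<ge> 2" by (simp_all add: A_def N R)
    show "?\<gamma> > 0" using K S by simp
    show "A $$ (i, j) = A $$ (j, i)" if "i < N" "j < N" for i j
    proof -
      have "pmf (swap_step n (Gs ! i)) (Gs ! j) = pmf (swap_step n (Gs ! j)) (Gs ! i)"
        by (simp only: pmf_swap_step[OF n] card_choices_sym[of n "Gs ! j" "Gs ! i"] eq_commute[of "Gs ! j" "Gs ! i"])
      then show ?thesis using that by (simp add: A_def)
    qed
    show "(\<Sum>j<N. A $$ (i, j)) = 1" if i: "i < N" for i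
    proof -
      have "(\<Sum>j<N. A $$ (i, j)) = (\<Sum>j<N. pmf (swap_step n (Gs ! i)) (Gs ! j))"
        using i by (simp add: A_def)
      also have "\<dots> = (\<Sum>H\<in>?R. pmf (swap_step n (Gs ! i)) H)" by (rule sum.reindex_bij_betw[OF bij])
      finally show ?thesis using sum_pmf_swap_step_eq_1[OF mem[OF i]] by simp
    qed
    show "?\<gamma> * (\<Sum>i<N. \<Sum>j<N. (f i - f j)\<^sup>2) \<le> real N * (\<Sum>i<N. \<Sum>j<N. A $$ (i, j) * (f i - f j)\<^sup>2)" for f
    proof -
      \<comment> \<open>The matrix inequality tests functions on indices, the inequality
        \<open>poincare\<close> functions on graphs; \<open>g\<close> transports \<open>f\<close>
        along the enumeration.\<close>
      define g where "g G = f (the_inv_into {..<N} (\<lambda>i. Gs ! i) G)" for G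
      have g: "f i = g (Gs ! i)" if "i < N" for i
        using the_inv_into_f_f[of "\<lambda>i. Gs ! i" "{..<N}" i] bij that by (simp add: g_def bij_betw_def)
      have "(\<Sum>i<N. \<Sum>j<N. (f i - f j)\<^sup>2) = (\<Sum>i<N. \<Sum>j<N. (g (Gs ! i) - g (Gs ! j))\<^sup>2)"
        by (simp add: g)
      also have "\<dots> = (\<Sum>G\<in>?R. \<Sum>H\<in>?R. (g G - g H)\<^sup>2)"
        by (rule reindex)
      finally have L: "(\<Sum>i<N. \<Sum>j<N. (f i - f j)\<^sup>2) = (\<Sum>G\<in>?R. \<Sum>H\<in>?R. (g G - g H)\<^sup>2)" .
      have "(\<Sum>i<N. \<Sum>j<N. A $$ (i, j) * (f i - f j)\<^sup>2) =
          (\<Sum>i<N. \<Sum>j<N. pmf (swap_step n (Gs ! i)) (Gs ! j) * (g (Gs ! i) - g (Gs ! j))\<^sup>2)"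
        by (simp add: g A_def)
      also have "\<dots> = (\<Sum>G\<in>?R. \<Sum>H\<in>?R. pmf (swap_step n G) H * (g G - g H)\<^sup>2)"
        by (rule reindex)
      also have "\<dots> = (\<Sum>G\<in>?R. (\<Sum>q\<in>?S. (g G - g (try_swap q G))\<^sup>2) / (2 * real (card ?S)))"
        by (intro sum.cong refl sum_pmf_swap_step[OF n]) auto
      also have "\<dots> = dirichlet n s g / (2 * real (card ?S))"
        by (simp add: dirichlet_def sum_divide_distrib power2_commute)
      finally have Rt: "(\<Sum>i<N. \<Sum>j<N. A $$ (i, j) * (f i - f j)\<^sup>2) = dirichlet n s g / (2 * real (card ?S))" .
      have "(\<Sum>G\<in>?R. \<Sum>H\<in>?R. (g G - g H)\<^sup>2) \<le> K * real N * dirichlet n s g"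
        using K(2) by (simp add: poincare_def N)
      moreover have "1 / (2 * K * c) * x \<le> y * (z / (2 * c))" if "x \<le> K * y * z" "c > 0" for c x y z :: real
        using that K(1) by (simp add: field_simps)
      ultimately show ?thesis unfolding L Rt using S by simp
    qed
  qed
  then show ?thesis by (simp add: A)
qed

text \<open>The summand 1 covers a unique realization, where the relaxation time is 1 by definition.
  Otherwise the bound is the inverse of the gap, with at most n^4 choices.\<close>

lemma relaxation_time_le:
  assumes s: "graphical n s" and K: "K > 0" "poincare K n s"
  shows "relaxation_time n s \<le> ereal (1 + 2 * K * real n ^ 4)"
proof (cases "card (realizations n s) = 1")
  case True
  then show ?thesis using K by (simp add: relaxation_time_def one_ereal_def)
next
  case False
  have n: "n \<ge> 2"
  proof (rule ccontr)
    assume "\<not> n \<ge> 2"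
    then have "swap_choices n = {}" by (auto simp: swap_choices_def)
    with poincare_unique_realization[OF K(2) s] False show False by simp
  qed
  have "card (realizations n s) \<noteq> 0" using s by (simp add: graphical_def)
  with False have R: "card (realizations n s) \<ge> 2" by linarith
  let ?S = "real (card (swap_choices n))"
  define l where "l = eigenvalue_list (transition_matrix n s) ! 1"
  have S: "?S > 0" using swap_choices_nonempty[OF n] by simp
  have gap: "1 / (2 * K * ?S) \<le> 1 - l"
    using second_eigenvalue_transition_matrix[OF n R K] by (simp add: l_def)
  have pos: "1 / (2 * K * ?S) > 0" using K S by simp
  with gap have pos': "1 - l > 0" by linarith
  have "1 / (1 - l) \<le> 1 / (1 / (2 * K * ?S))" using gap pos pos' by (intro divide_left_mono mult_pos_pos) auto
  also have "\<dots> = 2 * K * ?S" by simp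
  also have "\<dots> \<le> 2 * K * real n ^ 4"
    using K card_swap_choices_le[of n] by (intro mult_left_mono) (simp_all flip: of_nat_power)
  finally have "1 / (1 - l) \<le> 1 + 2 * K * real n ^ 4" by simp
  moreover have "1 - l \<noteq> 0" using gap pos by linarith
  ultimately show ?thesis using False
    unfolding relaxation_time_def l_def[symmetric] by (simp add: one_ereal_def)
qed

section \<open>Counting sequences with a common Poincare constant\<close>

lemma graphical_le:
  assumes "graphical n s" "i < n"
  shows "fst s ! i \<le> n" "snd s ! i \<le> n"
proof -
  obtain E where E: "E \<in> realizations n s" using assms by (auto simp: graphical_def)
  then have "E `` {i} \<subseteq> {..<n}" "E\<inverse> `` {i} \<subseteq> {..<n}" by (auto simp: realizations_iff)
  from this[THEN card_mono[rotated]] show "fst s ! i \<le> n" "snd s ! i \<le> n"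
    using E assms by (auto simp: realizations_iff)
qed

lemma bideg_seqs_length: "s \<in> bideg_seqs n \<Longrightarrow> length (fst s) = n \<and> length (snd s) = n"
  by (auto simp: bideg_seqs_def)

lemma finite_graphical_seqs: "finite {s \<in> bideg_seqs n. graphical n s}"
proof (rule finite_subset)
  let ?L = "{xs. set xs \<subseteq> {..n} \<and> length xs = n}"
  show "{s \<in> bideg_seqs n. graphical n s} \<subseteq> ?L \<times> ?L"
  proof
    fix s assume "s \<in> {s \<in> bideg_seqs n. graphical n s}"
    then show "s \<in> ?L \<times> ?L"
      using graphical_le[of n s] by (auto simp: bideg_seqs_def in_set_conv_nth)
  qed
  show "finite (?L \<times> ?L)" by (simp add: finite_lists_length_eq)
qed

text \<open>The constant \<open>K\<close> is the same for all n, which makes the family closed under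
  composition; the factor that depends on n enters only when passing to
  \<open>relaxation_time\<close>.\<close>

definition poincare_seqs :: "real \<Rightarrow> nat \<Rightarrow> bideg_seq set" where
  "poincare_seqs K n = {s \<in> bideg_seqs n. graphical n s \<and> poincare K n s}"

lemma finite_poincare_seqs: "finite (poincare_seqs K n)"
  by (rule finite_subset[OF _ finite_graphical_seqs[of n]]) (auto simp: poincare_seqs_def)

lemma compose_seq_poincare_seqs:
  assumes K: "K \<ge> 0" and s: "s \<in> poincare_seqs K k" and t: "t \<in> poincare_seqs K m"
  shows "compose_seq k m s t \<in> poincare_seqs K (k + m)"
proof -
  have s': "s \<in> bideg_seqs k" "graphical k s" "poincare K k s"
    and t': "t \<in> bideg_seqs m" "graphical m t" "poincare K m t"
    using s t by (auto simp: poincare_seqs_def)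
  have len: "length (fst s) = k" "length (snd s) = k" "length (fst t) = m" "length (snd t) = m"
    using bideg_seqs_length s' t' by auto
  obtain X Y where XY: "X \<in> realizations k s" "Y \<in> realizations m t"
    using s' t' by (auto simp: graphical_def)
  then have "compose_bigraph k m X Y \<in> realizations (k + m) (compose_seq k m s t)"
    using compose_realizations[OF len, of X Y] by (simp add: realizations_iff[of _ k] realizations_iff[of _ m])
  then have gr: "graphical (k + m) (compose_seq k m s t)" by (auto simp: graphical_def)
  \<comment> \<open>Degrees in \<open>t\<close> are at most \<open>m\<close>, and those of
    \<open>s\<close> are raised by \<open>m\<close>, so the list stays sorted where the two parts
    meet. The other class works the same way with \<open>k\<close>.\<close>
  have le: "x \<le> m" if "x \<in> set (fst t)" for x
    using that graphical_le[OF t'(2)] len by (auto simp: in_set_conv_nth)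
  have le': "x \<le> k" if "x \<in> set (snd s)" for x
    using that graphical_le[OF s'(2)] len by (auto simp: in_set_conv_nth)
  have "compose_seq k m s t \<in> bideg_seqs (k + m)"
    using s'(1) t'(1) le le'
    by (auto simp: bideg_seqs_def compose_seq_def sorted_wrt_append sorted_wrt_map trans_le_add2)
  then show ?thesis
    using gr poincare_compose[OF len s'(2) K s'(3) t'(3)] by (simp add: poincare_seqs_def)
qed

lemma compose_seq_inject:
  assumes "s \<in> bideg_seqs k" "s' \<in> bideg_seqs k" "t \<in> bideg_seqs m" "t' \<in> bideg_seqs m"
    and "compose_seq k m s t = compose_seq k m s' t'"
  shows "s = s' \<and> t = t'"
proof -
  have inj: "map (\<lambda>x. x + c) xs = map (\<lambda>x. x + c) ys \<longleftrightarrow> xs = ys" for c :: nat and xs ys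
    by (rule inj_map_eq_map) (simp add: inj_on_def)
  show ?thesis
    using assms(5) assms(1-4)[THEN bideg_seqs_length]
    by (auto simp: compose_seq_def inj prod_eq_iff)
qed

lemma card_poincare_seqs_add:
  assumes K: "K \<ge> 0" and all: "\<And>s. s \<in> bideg_seqs k \<Longrightarrow> graphical k s \<Longrightarrow> poincare K k s"
  shows "num_graphical k * card (poincare_seqs K m) \<le> card (poincare_seqs K (k + m))"
proof -
  have "{s \<in> bideg_seqs k. graphical k s} = poincare_seqs K k"
    using all by (auto simp: poincare_seqs_def)
  then have "num_graphical k * card (poincare_seqs K m) = card (poincare_seqs K k \<times> poincare_seqs K m)"
    by (simp add: num_graphical_def card_cartesian_product)
  also have "\<dots> \<le> card (poincare_seqs K (k + m))"
  proof (rule card_inj_on_le)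
    show "inj_on (\<lambda>(s, t). compose_seq k m s t) (poincare_seqs K k \<times> poincare_seqs K m)"
      unfolding inj_on_def poincare_seqs_def by (auto dest!: compose_seq_inject[rotated 4])
    show "(\<lambda>(s, t). compose_seq k m s t) ` (poincare_seqs K k \<times> poincare_seqs K m) \<subseteq> poincare_seqs K (k + m)"
      using compose_seq_poincare_seqs[OF K] by auto
  qed (rule finite_poincare_seqs)
  finally show ?thesis .
qed

text \<open>The zero sequence has the empty graph as its only realization, so its pair sum vanishes
  and every K \<ge> 0 works. It serves as filler for the n mod k vertices per class that no block
  covers.\<close>

lemma card_poincare_seqs_pos:
  assumes "K \<ge> 0"
  shows "card (poincare_seqs K n) \<ge> 1"
proof -
  define z where "z = (replicate n (0::nat), replicate n (0::nat))"
  have "realizations n z = {{}}"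
  proof
    show "realizations n z \<subseteq> {{}}"
    proof
      fix E assume E: "E \<in> realizations n z"
      have "(u, v) \<notin> E" for u v
      proof
        assume uv: "(u, v) \<in> E"
        then have "u < n" using E by (auto simp: realizations_iff)
        then have "card (E `` {u}) = 0" using E by (simp add: realizations_iff z_def)
        moreover have "finite (E `` {u})" using finite_realization[OF E] by (auto intro: finite_Image)
        ultimately show False using uv by auto
      qed
      then show "E \<in> {{}}" by auto
    qed
    show "{{}} \<subseteq> realizations n z" by (simp add: realizations_iff z_def)
  qed
  moreover have "z \<in> bideg_seqs n" by (simp add: z_def bideg_seqs_def sorted_wrt_iff_nth_less)
  ultimately have "z \<in> poincare_seqs K n"
    using assms by (simp add: poincare_seqs_def graphical_def poincare_def dirichlet_nonneg)
  then show ?thesis using finite_poincare_seqs[of K n] by (auto simp: Suc_le_eq card_gt_0_iff)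
qed

lemma card_poincare_seqs_ge:
  assumes K: "K \<ge> 0" and k: "k \<ge> 1"
    and all: "\<And>s. s \<in> bideg_seqs k \<Longrightarrow> graphical k s \<Longrightarrow> poincare K k s"
  shows "num_graphical k ^ (n div k) \<le> card (poincare_seqs K n)"
proof (induction n rule: less_induct)
  case (less n)
  show ?case
  proof (cases "n < k")
    case True
    then show ?thesis using card_poincare_seqs_pos[OF K] by simp
  next
    case False
    then have "n div k = Suc ((n - k) div k)" using k by (simp add: le_div_geq)
    then have "num_graphical k ^ (n div k) \<le> num_graphical k * card (poincare_seqs K (n - k))"
      using less[of "n - k"] False k by simp
    also have "\<dots> \<le> card (poincare_seqs K n)"
      using card_poincare_seqs_add[OF K all, of "n - k"] False by simp
    finally show ?thesis .
  qed
qed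

lemma uniform_poincare_constant:
  "\<exists>K>0. \<forall>s\<in>bideg_seqs k. graphical k s \<longrightarrow> poincare K k s"
proof -
  obtain L where L: "\<And>s. poincare (L s) k s" using poincare_exists by metis
  let ?T = "{s \<in> bideg_seqs k. graphical k s}"
  \<comment> \<open>The sum over the finitely many graphical sequences dominates each constant,
    absolute values guard against negative ones, and the 1 makes \<open>K\<close> strictly
    positive.\<close>
  define K where "K = 1 + (\<Sum>s\<in>?T. \<bar>L s\<bar>)"
  have "poincare K k s" if "s \<in> ?T" for s
  proof (rule poincare_mono[OF L])
    have "\<bar>L s\<bar> \<le> (\<Sum>s\<in>?T. \<bar>L s\<bar>)" by (rule member_le_sum) (use that finite_graphical_seqs in auto)
    then show "L s \<le> K" by (simp add: K_def)
  qed
  moreover have "K > 0" unfolding K_def by (simp add: add_pos_nonneg sum_nonneg)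
  ultimately show ?thesis by blast
qed

theorem theorem5p9:
  fixes C :: real
  assumes "(\<lambda>n. real (num_graphical n)) \<in> \<Omega>(\<lambda>n. C ^ n)"
  shows "\<forall>\<epsilon>::real. 0 < \<epsilon> \<and> \<epsilon> \<le> C \<longrightarrow>
    (\<exists>p :: real poly. (\<lambda>n. real (num_fast_mixing p n)) \<in> \<Omega>(\<lambda>n. (C - \<epsilon>) ^ n))"
proof (intro allI impI)
  fix \<epsilon> :: real assume \<epsilon>: "0 < \<epsilon> \<and> \<epsilon> \<le> C"
  define D where "D = C - \<epsilon>"
  have D: "0 \<le> D" "D < C" and C: "C > 0" using \<epsilon> by (auto simp: D_def)
  obtain c where c: "c > 0" and ev: "eventually (\<lambda>n. c * norm (C ^ n) \<le> norm (real (num_graphical n))) at_top"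
    using landau_omega.bigE[OF assms] by blast
  \<comment> \<open>This fixes the block size: as soon as (D / C)^k < c, the lower bound c * C^k on
    \<open>num_graphical k\<close> is at least D^k, so the constant hidden in \<Omega> is absorbed
    by a single block.\<close>
  have "(\<lambda>n. (D / C) ^ n) \<longlonglongrightarrow> 0"
    using D C by (intro LIMSEQ_power_zero) simp
  then have "eventually (\<lambda>n. (D / C) ^ n < c) at_top" using c by (rule order_tendstoD)
  then have "eventually (\<lambda>n. c * norm (C ^ n) \<le> norm (real (num_graphical n)) \<and> (D / C) ^ n < c \<and> n \<ge> 1) at_top"
    using ev eventually_ge_at_top[of 1] by eventually_elim simp
  then obtain k where k: "c * norm (C ^ k) \<le> norm (real (num_graphical k))" "(D / C) ^ k < c" "k \<ge> 1"
    using eventually_happens'[OF sequentially_bot] by blast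
  have "D ^ k = (D / C) ^ k * C ^ k" using C by (simp add: power_divide)
  also have "\<dots> \<le> c * C ^ k" using k(2) C by (intro mult_right_mono) auto
  also have "\<dots> \<le> real (num_graphical k)" using k(1) C by simp
  finally have Dk: "D ^ k \<le> real (num_graphical k)" .
  obtain K where K: "K > 0" and all: "\<And>s. s \<in> bideg_seqs k \<Longrightarrow> graphical k s \<Longrightarrow> poincare K k s"
    using uniform_poincare_constant by blast
  define p where "p = [:1:] + monom (2 * K) 4"
  have p: "poly p (real n) = 1 + 2 * K * real n ^ 4" for n by (simp add: p_def poly_monom)
  \<comment> \<open>\<open>M\<close> absorbs the factor D ^ (n mod k) of the incomplete block; the
    maximum with 1 covers D < 1.\<close>
  define M where "M = max 1 D ^ k"
  have M: "M > 0" unfolding M_def by simp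
  have "D ^ n \<le> M * real (num_fast_mixing p n)" for n
  proof -
    have "D ^ n = (D ^ k) ^ (n div k) * D ^ (n mod k)"
      by (simp flip: power_mult power_add)
    also have "\<dots> \<le> real (num_graphical k) ^ (n div k) * M"
    proof (intro mult_mono power_mono Dk)
      have "D ^ (n mod k) \<le> max 1 D ^ (n mod k)" using D by (intro power_mono) auto
      also have "\<dots> \<le> M" unfolding M_def using k(3) by (intro power_increasing) auto
      finally show "D ^ (n mod k) \<le> M" .
    qed (use D in auto)
    also have "real (num_graphical k) ^ (n div k) \<le> real (card (poincare_seqs K n))"
      using card_poincare_seqs_ge[OF _ k(3) all, of n] K by (simp flip: of_nat_power)
    also have "card (poincare_seqs K n) \<le> num_fast_mixing p n"
      unfolding num_fast_mixing_def
    proof (rule card_mono)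
      show "finite {s \<in> bideg_seqs n. graphical n s \<and> relaxation_time n s \<le> ereal (poly p (real n))}"
        by (rule finite_subset[OF _ finite_graphical_seqs[of n]]) auto
      show "poincare_seqs K n \<subseteq> {s \<in> bideg_seqs n. graphical n s \<and> relaxation_time n s \<le> ereal (poly p (real n))}"
        unfolding p using relaxation_time_le[OF _ K] by (auto simp: poincare_seqs_def)
    qed
    finally show ?thesis using M by (simp add: mult_ac)
  qed
  then have "inverse M * norm (D ^ n) \<le> norm (real (num_fast_mixing p n))" for n
    using D M by (simp add: field_simps)
  then have "(\<lambda>n. real (num_fast_mixing p n)) \<in> \<Omega>(\<lambda>n. D ^ n)"
    using M by (intro landau_omega.bigI[of "inverse M"]) auto
  then show "\<exists>p :: real poly. (\<lambda>n. real (num_fast_mixing p n)) \<in> \<Omega>(\<lambda>n. (C - \<epsilon>) ^ n)"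
    unfolding D_def by blast
qed

end
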